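(* Let $p>3$ be a prime and $r\ge 1$ an integer. Then $$\sum_{k=0}^{p^r-1}(3k+1)\frac{(\frac12)_k^3}{(1)_k^3}4^k\equiv p^r+\frac76p^{r+3}B_{p-3}\pmod{p^{r+4}}.$$
   Context: $(x)_k=x(x+1)\cdots(x+k-1)$ is the Pochhammer symbol, with $(x)_0=1$. $B_0,B_1,B_2,\dots$ are the Bernoulli numbers. A congruence $a\equiv b\pmod{p^m}$ between rational numbers means that $(a-b)/p^m$ is a rational number whose denominator is not divisible by $p$. *)

theory Defs
  imports Complex_Main "HOL-Computational_Algebra.Primes"
begin

text \<open>Bernoulli numbers via the standard recurrence
  B_0 = 1, sum_{k=0}^{n} C(n+1,k) B_k = 0 for n \<ge> 1 (so B_1 = -1/2).\<close>
fun bernoulli :: "nat \<Rightarrow> rat" where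
  "bernoulli n = (if n = 0 then 1 else
     - (\<Sum>k<n. of_nat ((n + 1) choose k) * bernoulli k) / of_nat (n + 1))"

definition rat_cong :: "rat \<Rightarrow> rat \<Rightarrow> nat \<Rightarrow> nat \<Rightarrow> bool" where
  "rat_cong a b p m \<longleftrightarrow>
     \<not> (int p dvd snd (quotient_of ((a - b) / of_nat (p ^ m))))"

end

theory Submission
  imports Defs "HOL-Computational_Algebra.Polynomial" "HOL-Number_Theory.Residues"
begin

text \<open>
  Replace \<open>1/2\<close> by a variable: for \<open>c\<^sub>k = (1/2)\<^sub>k 4\<^sup>k / k!\<^sup>3\<close> the polynomial
  \<open>P(w) = (\<Sum>k<n. (3k + 2w) (w)\<^sub>k\<^sup>2 c\<^sub>k)\<close> satisfies \<open>P(w+1) - P(w) = n\<^sup>3 c\<^sub>n (w+1)\<^bsub>n-1\<^esub>\<^sup>2\<close>, and so does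
  \<open>2 / (n-1)!\<^sup>2 (w)\<^sub>n\<^sup>2 (\<Sum>m<n. (n-1 choose m)\<^sup>2 / (w+m))\<close>; hence both polynomials agree. At \<open>w = 1/2\<close>, for
  odd \<open>n = 2h+1\<close>, the terms \<open>m = h + j\<close> and \<open>m = h - j\<close> combine, and the sum in question equals
  \<open>n \<Prod>\<^bsub>i\<le>h\<^esub> (1 - n\<^sup>2/4i\<^sup>2)\<^sup>2 (1 - \<Sum>\<^bsub>j\<le>h\<^esub> 2n\<^sup>2 / (4j\<^sup>2 - n\<^sup>2) \<Prod>\<^bsub>a\<^esub> ((n-a)/(n+a))\<^sup>2)\<close>, where \<open>a\<close> runs over the odd
  numbers below \<open>2j\<close>. For \<open>n = p\<^sup>r\<close> every \<open>n/i\<close> here is divisible by \<open>p\<close>, so modulo \<open>p\<^sup>4\<close> the cofactor of \<open>n\<close>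
  is \<open>1 - \<Sum>\<^bsub>j\<^esub> (n/j)\<^sup>2 (1 - 2 \<Sum>\<^bsub>a\<^esub> n/a)\<close>, to which only multiples of \<open>p\<^bsup>r-1\<^esup>\<close> contribute: the value is the
  one for \<open>r = 1\<close>. Splitting \<open>1, \<dots>, p-1\<close> both as \<open>k, p-k\<close> and as \<open>2k, p-2k\<close> with \<open>k \<le> (p-1)/2\<close> reduces the
  harmonic sums that remain to \<open>\<Sum>\<^bsub>j<s<p\<^esub> 1/(j s\<^sup>2)\<close>, which is \<open>B\<^bsub>p-3\<^esub>\<close> modulo \<open>p\<close> by Faulhaber's formula and
  Fermat's little theorem.
\<close>

declare bernoulli.simps [simp del]

section \<open>A polynomial identity\<close>

definition hyp_coeff :: "nat \<Rightarrow> rat" where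
  "hyp_coeff k = pochhammer (1/2) k * 4 ^ k / fact k ^ 3"

text \<open>Only two of the three factors (1/2)_k are freed to a variable; the third stays in
  \<open>hyp_coeff\<close>. At w = 1/2 the original sum returns, as 3k + 2w becomes 3k + 1.\<close>

definition hyp_sum :: "nat \<Rightarrow> rat \<Rightarrow> rat" where
  "hyp_sum n w = (\<Sum>k<n. (3 * of_nat k + 2 * w) * pochhammer w k ^ 2 * hyp_coeff k)"

lemma hyp_coeff_Suc: "of_nat (Suc k) ^ 3 * hyp_coeff (Suc k) = 2 * (2 * of_nat k + 1) * hyp_coeff k"
proof -
  define n :: rat where "n = of_nat (Suc k)"
  have "n \<noteq> 0" unfolding n_def by (rule of_nat_neq_0)
  then have "n ^ 3 * hyp_coeff (Suc k) = (1/2 + of_nat k) * 4 * (pochhammer (1/2) k * 4 ^ k / fact k ^ 3)"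
    by (simp add: hyp_coeff_def pochhammer_Suc power_mult_distrib power_divide del: of_nat_Suc flip: n_def)
  then show ?thesis unfolding n_def[symmetric] hyp_coeff_def[of k, symmetric] by (simp add: algebra_simps)
qed

text \<open>With n = N + 1 the right-hand side is n^3 c_n (w+1)_N^2 by \<open>hyp_coeff_Suc\<close>.
  Induction on N works because the new summand contributes exactly the growth of this
  expression.\<close>

lemma hyp_sum_diff:
  "hyp_sum (Suc N) (w + 1) - hyp_sum (Suc N) w =
     2 * (2 * of_nat N + 1) * hyp_coeff N * pochhammer (w + 1) N ^ 2"
proof (induction N)
  case 0
  then show ?case by (simp add: hyp_sum_def hyp_coeff_def)
next
  case (Suc N)
  define n :: rat where "n = of_nat (Suc N)"
  define X where "X = pochhammer (w + 1) N"
  define c where "c = hyp_coeff (Suc N)"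
  have a: "pochhammer (w + 1) (Suc N) = X * (w + n)"
    by (simp add: pochhammer_Suc X_def n_def algebra_simps)
  have b: "pochhammer w (Suc N) = w * X"
    by (simp add: pochhammer_rec X_def)
  have c: "n ^ 3 * c = 2 * (2 * of_nat N + 1) * hyp_coeff N"
    unfolding n_def c_def by (rule hyp_coeff_Suc)
  have "hyp_sum (Suc (Suc N)) (w + 1) - hyp_sum (Suc (Suc N)) w =
      (hyp_sum (Suc N) (w + 1) - hyp_sum (Suc N) w)
      + (3 * n + 2 * (w + 1)) * (X * (w + n)) ^ 2 * c - (3 * n + 2 * w) * (w * X) ^ 2 * c"
    unfolding hyp_sum_def sum.lessThan_Suc[of _ "Suc N"] unfolding a b n_def c_def by simp
  \<comment> \<open>The previous right-hand side is written as a multiple of c, so that only n^3 +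
    (3n+2w+2)(w+n)^2 - (3n+2w)w^2 = 2(2n+1)(w+n)^2 remains.\<close>
  also have "\<dots> = n ^ 3 * c * X ^ 2
      + (3 * n + 2 * (w + 1)) * (X * (w + n)) ^ 2 * c - (3 * n + 2 * w) * (w * X) ^ 2 * c"
    by (simp only: Suc.IH c X_def)
  also have "\<dots> = 2 * (2 * n + 1) * c * (X * (w + n)) ^ 2"
    by (simp add: algebra_simps power2_eq_square power3_eq_cube)
  finally show ?case by (simp only: a n_def c_def)
qed

lemma hyp_sum_0 [simp]: "hyp_sum n 0 = 0"
  by (auto simp: hyp_sum_def pochhammer_0_left intro!: sum.neutral)

text \<open>For \<open>n = N + 1\<close> this is \<open>(w)\<^sub>n\<^sup>2 (\<Sum>m. (N choose m)\<^sup>2 / (w + m))\<close>, written without division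
  so that it is visibly a polynomial in \<open>w\<close>.\<close>
definition interp :: "nat \<Rightarrow> rat \<Rightarrow> rat" where
  "interp N w = (\<Sum>m\<le>N. of_nat (N choose m) ^ 2 *
     (pochhammer w (Suc N) * pochhammer w m * pochhammer (w + of_nat m + 1) (N - m)))"

lemma pochhammer_remove_factor:
  fixes w :: "'a::comm_ring_1"
  assumes "m \<le> N"
  shows "pochhammer w (Suc N) =
    (w + of_nat m) * (pochhammer w m * pochhammer (w + of_nat m + 1) (N - m))"
proof -
  have "pochhammer w (Suc N) = pochhammer w m * pochhammer (w + of_nat m) (Suc (N - m))"
    using pochhammer_product[of m "Suc N" w] assms by (simp add: Suc_diff_le)
  then show ?thesis by (simp add: pochhammer_rec mult_ac)
qed

lemma interp_eq:
  assumes "\<And>m. m \<le> N \<Longrightarrow> w + of_nat m \<noteq> 0"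
  shows "interp N w = pochhammer w (Suc N) ^ 2 * (\<Sum>m\<le>N. of_nat (N choose m) ^ 2 / (w + of_nat m))"
  unfolding interp_def sum_distrib_left
proof (rule sum.cong)
  fix m assume "m \<in> {..N}"
  then have m: "m \<le> N" by simp
  show "of_nat (N choose m) ^ 2 *
     (pochhammer w (Suc N) * pochhammer w m * pochhammer (w + of_nat m + 1) (N - m)) =
     pochhammer w (Suc N) ^ 2 * (of_nat (N choose m) ^ 2 / (w + of_nat m))"
    using assms[OF m] pochhammer_remove_factor[OF m, of w]
    by (simp add: field_simps power2_eq_square)
qed simp

text \<open>Division by w+1+m and by w+m leaves the remainders (N-m)^2 and m^2. By absorption,
  (N-m)(N choose m) = (m+1)(N choose m+1), the two remainder sums agree after an index shift. The
  polynomial parts differ by 2N+1 times the sum of the squared binomials.\<close>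

lemma partial_fraction_shift:
  assumes pos: "w > (0::rat)"
  shows "(w + of_nat N + 1) ^ 2 * (\<Sum>m\<le>N. of_nat (N choose m) ^ 2 / (w + 1 + of_nat m))
       - w ^ 2 * (\<Sum>m\<le>N. of_nat (N choose m) ^ 2 / (w + of_nat m))
       = of_nat (2 * N + 1) * of_nat ((2 * N) choose N)"
proof -
  let ?b = "\<lambda>m. of_nat (N choose m) ^ 2 :: rat"
  have 1: "(w + of_nat N + 1) ^ 2 * (?b m / (w + 1 + of_nat m)) =
      ?b m * (w + 2 * of_nat N + 1 - of_nat m) + (of_nat (N - m) * of_nat (N choose m)) ^ 2 / (w + of_nat (Suc m))"
    if "m \<le> N" for m
  proof -
    have "w + 1 + of_nat m \<noteq> 0" using pos by (simp add: add_nonneg_eq_0_iff add_pos_nonneg order_less_imp_not_eq2)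
    then show ?thesis using that
      by (simp add: of_nat_diff field_simps) (simp add: algebra_simps power2_eq_square)
  qed
  have 2: "w ^ 2 * (?b m / (w + of_nat m)) =
      ?b m * (w - of_nat m) + (of_nat m * of_nat (N choose m)) ^ 2 / (w + of_nat m)" for m
  proof -
    have "w + of_nat m \<noteq> 0" using pos by (simp add: add_pos_nonneg order_less_imp_not_eq2)
    then show ?thesis
      by (simp add: field_simps) (simp add: algebra_simps power2_eq_square)
  qed
  have 3: "(\<Sum>m\<le>N. (of_nat (N - m) * of_nat (N choose m)) ^ 2 / (w + of_nat (Suc m))) =
     (\<Sum>m\<le>N. (of_nat m * of_nat (N choose m)) ^ 2 / (w + of_nat m))"
  proof -
    let ?f = "\<lambda>m. (of_nat m * of_nat (N choose m)) ^ 2 / (w + of_nat m)"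
    have "of_nat (N - m) * of_nat (N choose m) = (of_nat (Suc m) * of_nat (N choose Suc m) :: rat)" if "m < N" for m
      by (metis binomial_absorb_comp binomial_absorption of_nat_mult)
    then have "(\<Sum>m<N. (of_nat (N - m) * of_nat (N choose m)) ^ 2 / (w + of_nat (Suc m))) =
        (\<Sum>m<N. ?f (Suc m))"
      by (intro sum.cong refl) (simp only: lessThan_iff)
    then show ?thesis
      unfolding sum.atMost_shift[of ?f] by (simp add: lessThan_Suc_atMost[symmetric] del: of_nat_Suc)
  qed
  have "(\<Sum>m\<le>N. ?b m) = of_nat ((2 * N) choose N)"
    using choose_square_sum[of N] by (simp flip: of_nat_power of_nat_sum)
  moreover have "(w + of_nat N + 1) ^ 2 * (\<Sum>m\<le>N. ?b m / (w + 1 + of_nat m)) =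
      (\<Sum>m\<le>N. ?b m * (w + 2 * of_nat N + 1 - of_nat m))
      + (\<Sum>m\<le>N. (of_nat (N - m) * of_nat (N choose m)) ^ 2 / (w + of_nat (Suc m)))"
    unfolding sum_distrib_left sum.distrib[symmetric] by (rule sum.cong) (use 1 in simp_all)
  moreover have "w ^ 2 * (\<Sum>m\<le>N. ?b m / (w + of_nat m)) =
      (\<Sum>m\<le>N. ?b m * (w - of_nat m)) + (\<Sum>m\<le>N. (of_nat m * of_nat (N choose m)) ^ 2 / (w + of_nat m))"
    unfolding sum_distrib_left sum.distrib[symmetric] by (rule sum.cong) (simp_all only: 2)
  moreover have "(\<Sum>m\<le>N. ?b m * (w + 2 * of_nat N + 1 - of_nat m)) =
      (\<Sum>m\<le>N. ?b m * (w - of_nat m)) + of_nat (2 * N + 1) * (\<Sum>m\<le>N. ?b m)"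
    unfolding sum_distrib_left sum.distrib[symmetric] by (rule sum.cong) (simp_all add: algebra_simps)
  ultimately show ?thesis by (simp only: 3)
qed

text \<open>Both values carry the factor (w+1)_N^2; what is left is
  \<open>partial_fraction_shift\<close>. Positivity of w keeps all w+m away from zero.\<close>

lemma interp_diff:
  assumes pos: "w > 0"
  shows "interp N (w + 1) - interp N w =
    of_nat (2 * N + 1) * of_nat ((2 * N) choose N) * pochhammer (w + 1) N ^ 2"
proof -
  have nz: "w + of_nat m \<noteq> 0" "w + 1 + of_nat m \<noteq> 0" for m
    using pos by (simp_all add: add_pos_nonneg order_less_imp_not_eq2)
  have "pochhammer (w + 1) (Suc N) = pochhammer (w + 1) N * (w + of_nat N + 1)"
    "pochhammer w (Suc N) = w * pochhammer (w + 1) N"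
    by (simp_all only: pochhammer_Suc[of "w+1"] pochhammer_rec[of w]) (simp add: add_ac)
  then have "interp N (w + 1) - interp N w = pochhammer (w + 1) N ^ 2 *
     ((w + of_nat N + 1) ^ 2 * (\<Sum>m\<le>N. of_nat (N choose m) ^ 2 / (w + 1 + of_nat m))
       - w ^ 2 * (\<Sum>m\<le>N. of_nat (N choose m) ^ 2 / (w + of_nat m)))"
    by (simp only: interp_eq[OF nz(1)] interp_eq[OF nz(2)] power_mult_distrib right_diff_distrib mult_ac)
  then show ?thesis by (simp only: partial_fraction_shift[OF pos] mult_ac)
qed

text \<open>The duplication formula for (2N)!. It makes the constants in \<open>hyp_sum_diff\<close>
  and \<open>interp_diff\<close> match.\<close>

lemma hyp_coeff_eq: "hyp_coeff N = of_nat ((2 * N) choose N) / fact N ^ 2"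
proof -
  have "fact (2 * N) = 4 ^ N * pochhammer (1/2) N * (fact N :: rat)"
    using fact_double[of N, where 'a = rat] by (simp add: power_mult)
  then show ?thesis
    by (simp add: hyp_coeff_def binomial_fact field_simps power2_eq_square power3_eq_cube mult_2)
qed

section \<open>Comparison of the two polynomials at the positive integers\<close>

lemma poly_pochhammer: "poly (pochhammer q k) (x::'a::comm_ring_1) = pochhammer (poly q x) k"
  by (induction k) (simp_all add: pochhammer_Suc)

lemma poly_eqI_of_nat:
  fixes p q :: "'a::field_char_0 poly"
  assumes "\<And>m::nat. m > 0 \<Longrightarrow> poly p (of_nat m) = poly q (of_nat m)"
  shows "p = q"
proof (rule ccontr)
  assume "p \<noteq> q"
  then have "finite {x. poly (p - q) x = 0}" by (intro poly_roots_finite) simp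
  moreover have "of_nat ` {0::nat<..} \<subseteq> {x. poly (p - q) x = 0}" using assms by auto
  ultimately have "finite (of_nat ` {0::nat<..} :: 'a set)" by (rule finite_subset[rotated])
  then have "finite {0::nat<..}" by (rule finite_imageD) (simp add: inj_on_def)
  then show False using infinite_Ioi by blast
qed

text \<open>Equal differences at positive w make A - B constant on the positive integers, hence a
  constant polynomial, and both sides vanish at w = 0.\<close>

theorem hyp_sum_eq_interp: "fact N ^ 2 * hyp_sum (Suc N) w = 2 * interp N w"
proof -
  define A :: "rat poly" where "A = (\<Sum>k<Suc N. [:3 * of_nat k, 2:] * pochhammer [:0, 1:] k ^ 2 * [:fact N ^ 2 * hyp_coeff k:])"
  define B :: "rat poly" where "B = 2 * (\<Sum>m\<le>N. [:of_nat (N choose m) ^ 2:] *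
     (pochhammer [:0, 1:] (Suc N) * pochhammer [:0, 1:] m * pochhammer [:of_nat m + 1, 1:] (N - m)))"
  have A: "poly A w = fact N ^ 2 * hyp_sum (Suc N) w" for w
    by (simp add: A_def hyp_sum_def poly_sum poly_pochhammer sum_distrib_left algebra_simps del: sum.lessThan_Suc)
  have B: "poly B w = 2 * interp N w" for w
    by (simp add: B_def interp_def poly_sum poly_pochhammer algebra_simps del: sum.atMost_Suc)
  have diff: "poly A (w + 1) - poly A w = poly B (w + 1) - poly B w" if "w > 0" for w
  proof -
    have "poly A (w + 1) - poly A w = fact N ^ 2 * (hyp_sum (Suc N) (w + 1) - hyp_sum (Suc N) w)"
      by (simp add: A algebra_simps)
    also have "\<dots> = 2 * (interp N (w + 1) - interp N w)"
      by (simp add: hyp_sum_diff interp_diff[OF that] hyp_coeff_eq)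
    finally show ?thesis by (simp add: B algebra_simps)
  qed
  obtain d where d: "\<And>m::nat. m > 0 \<Longrightarrow> poly (A - B) (of_nat m) = d"
  proof
    fix m :: nat assume "m > 0"
    then show "poly (A - B) (of_nat m) = poly (A - B) 1"
    proof (induction m rule: nat_induct_non_zero)
      case (Suc m)
      then show ?case using diff[of "of_nat m"] by (simp add: add_ac)
    qed simp
  qed
  have "A - B = [:d:]" by (rule poly_eqI_of_nat) (use d in simp)
  moreover have "poly (A - B) 0 = 0" by (simp add: A B interp_def pochhammer_0_left)
  ultimately have "d = 0" by simp
  with \<open>A - B = [:d:]\<close> have "A = B" by simp
  then show ?thesis using A[of w] B[of w] by simp
qed

lemma hyp_sum_half:
  "(\<Sum>k<Suc N. of_nat (3 * k + 1) * pochhammer (1/2 :: rat) k ^ 3 / pochhammer 1 k ^ 3 * 4 ^ k) =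
   4 * pochhammer (1/2) (Suc N) ^ 2 / fact N ^ 2 * (\<Sum>m\<le>N. of_nat (N choose m) ^ 2 / of_nat (2 * m + 1))"
proof -
  have nz: "(1/2::rat) + of_nat m \<noteq> 0" for m by (simp add: add_pos_nonneg order_less_imp_not_eq2)
  have "(\<Sum>k<Suc N. of_nat (3 * k + 1) * pochhammer (1/2 :: rat) k ^ 3 / pochhammer 1 k ^ 3 * 4 ^ k)
     = hyp_sum (Suc N) (1/2)"
    unfolding hyp_sum_def hyp_coeff_def
    by (intro sum.cong refl) (simp add: pochhammer_fact power2_eq_square power3_eq_cube mult_ac)
  also have "\<dots> = 2 * interp N (1/2) / fact N ^ 2"
    using hyp_sum_eq_interp[of N "1/2"] by (simp add: field_simps)
  also have "interp N (1/2) = pochhammer (1/2) (Suc N) ^ 2 * (\<Sum>m\<le>N. of_nat (N choose m) ^ 2 / (1/2 + of_nat m))"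
    by (rule interp_eq) (rule nz)
  also have "(\<Sum>m\<le>N. of_nat (N choose m) ^ 2 / (1/2 + of_nat m)) = (\<Sum>m\<le>N. 2 * (of_nat (N choose m) ^ 2 / of_nat (2 * m + 1) :: rat))"
    using nz by (intro sum.cong refl) (simp add: divide_simps)
  finally show ?thesis by (simp only: sum_distrib_left[symmetric]) simp
qed

section \<open>The sum over an odd range\<close>

definition odds :: "nat \<Rightarrow> nat set" where
  "odds j = {a. odd a \<and> a < 2 * j}"

lemma odds_0 [simp]: "odds 0 = {}"
  and odds_Suc: "odds (Suc j) = insert (2 * j + 1) (odds j)"
  and finite_odds [simp]: "finite (odds j)"
  and notin_odds: "2 * j + 1 \<notin> odds j"
  by (auto simp: odds_def elim: oddE)

lemma sum_atMost_symmetric: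
  fixes f :: "nat \<Rightarrow> 'a::comm_monoid_add"
  shows "(\<Sum>m\<le>2 * h. f m) = f h + (\<Sum>j = 1..h. f (h + j) + f (h - j))"
proof -
  have "{..2 * h} = {..<h} \<union> ({h} \<union> {h + 1..h + h})" by auto
  moreover have "sum f ({..<h} \<union> ({h} \<union> {h + 1..h + h})) = sum f {..<h} + sum f ({h} \<union> {h + 1..h + h})"
    by (rule sum.union_disjoint) auto
  ultimately have "(\<Sum>m\<le>2 * h. f m) = (\<Sum>m<h. f m) + (f h + (\<Sum>m = h + 1..h + h. f m))"
    by simp
  moreover have "(\<Sum>m = h + 1..h + h. f m) = (\<Sum>j = 1..h. f (h + j))"
    using sum.shift_bounds_cl_nat_ivl[of f 1 h h] by (simp add: add.commute)
  moreover have "(\<Sum>m<h. f m) = (\<Sum>j = 1..h. f (h - j))"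
    by (rule sum.reindex_bij_witness[of _ "\<lambda>j. h - j" "\<lambda>m. h - m"]) auto
  ultimately show ?thesis by (simp add: sum.distrib add_ac)
qed

text \<open>The quotient of neighbouring binomials is (h-j)/(h+j+1). Doubling numerator and
  denominator gives (n-a)/(n+a) with n = 2h+1 and a = 2j+1.\<close>

lemma binomial_ratio:
  assumes "j \<le> h"
  shows "of_nat ((2 * h) choose (h + j)) / of_nat ((2 * h) choose h) =
    (\<Prod>a\<in>odds j. (of_nat (2 * h + 1) - of_nat a) / (of_nat (2 * h + 1) + of_nat a) :: rat)"
  using assms
proof (induction j)
  case (Suc j)
  have "Suc (h + j) * ((2 * h) choose Suc (h + j)) = (h - j) * ((2 * h) choose (h + j))"
    using binomial_absorption[of "h + j" "2 * h"] binomial_absorb_comp[of "2 * h" "h + j"] by (simp add: mult_2)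
  then have "of_nat (Suc (h + j)) * of_nat ((2 * h) choose Suc (h + j)) = (of_nat h - of_nat j) * (of_nat ((2 * h) choose (h + j)) :: rat)"
    using Suc.prems by (metis Suc_leD of_nat_diff of_nat_mult)
  then have "of_nat ((2 * h) choose Suc (h + j)) = (of_nat ((2 * h) choose (h + j)) :: rat) * ((of_nat h - of_nat j) / of_nat (Suc (h + j)))"
    by (simp add: field_simps del: of_nat_Suc)
  also have "(of_nat h - of_nat j) / of_nat (Suc (h + j)) =
      (of_nat (2 * h + 1) - of_nat (2 * j + 1)) / (of_nat (2 * h + 1) + of_nat (2 * j + 1) :: rat)"
  proof -
    have "(of_nat (2 * h + 1) - of_nat (2 * j + 1)) = 2 * (of_nat h - of_nat j :: rat)"
      "(of_nat (2 * h + 1) + of_nat (2 * j + 1)) = 2 * (of_nat (Suc (h + j)) :: rat)" by simp_all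
    then show ?thesis by (simp only: mult_divide_mult_cancel_left_if) simp
  qed
  finally have eq: "(of_nat ((2 * h) choose Suc (h + j)) :: rat) = of_nat ((2 * h) choose (h + j)) *
    ((of_nat (2 * h + 1) - of_nat (2 * j + 1)) / (of_nat (2 * h + 1) + of_nat (2 * j + 1)))" .
  show ?case
    unfolding odds_Suc prod.insert[OF finite_odds notin_odds] add_Suc_right eq Suc.IH[OF Suc_leD[OF Suc.prems], symmetric]
    by (simp only: divide_inverse mult_ac)
qed simp

text \<open>The 2h+1 factors 1/2, 3/2, ... are symmetric about x = (2h+1)/2; the factors x-i and x+i
  are paired.\<close>

lemma pochhammer_half_odd:
  "pochhammer (1/2 :: rat) (2 * h + 1) =
     of_nat (2 * h + 1) / 2 * (\<Prod>i = 1..h. (of_nat (2 * h + 1) / 2) ^ 2 - of_nat i ^ 2)"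
proof -
  let ?x = "of_nat (2 * h + 1) / 2 :: rat"
  \<comment> \<open>For the induction the centre x stays fixed while the window of 2k+1 factors
    grows by one at each end; k = h starts it at 1/2.\<close>
  have "pochhammer (?x - of_nat k) (2 * k + 1) = ?x * (\<Prod>i = 1..k. ?x ^ 2 - of_nat i ^ 2)" for k
  proof (induction k)
    case (Suc k)
    have "pochhammer (?x - of_nat (Suc k)) (2 * Suc k + 1) =
        (?x - of_nat (Suc k)) * pochhammer (?x - of_nat (Suc k) + 1) (Suc (2 * k + 1))"
      by (simp add: pochhammer_rec)
    also have "?x - of_nat (Suc k) + 1 = ?x - of_nat k" by simp
    also have "pochhammer (?x - of_nat k) (Suc (2 * k + 1)) =
        pochhammer (?x - of_nat k) (2 * k + 1) * (?x - of_nat k + of_nat (2 * k + 1))"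
      by (rule pochhammer_Suc)
    also have "?x - of_nat k + of_nat (2 * k + 1) = ?x + of_nat (Suc k)" by simp
    finally have "pochhammer (?x - of_nat (Suc k)) (2 * Suc k + 1) =
        (?x ^ 2 - of_nat (Suc k) ^ 2) * pochhammer (?x - of_nat k) (2 * k + 1)"
      by (simp only: power2_eq_square square_diff_square_factored mult_ac)
    also have "\<dots> = ?x * ((\<Prod>i = 1..k. ?x ^ 2 - of_nat i ^ 2) * (?x ^ 2 - of_nat (Suc k) ^ 2))"
      unfolding Suc.IH by (simp only: mult_ac)
    also have "(\<Prod>i = 1..k. ?x ^ 2 - of_nat i ^ 2) * (?x ^ 2 - of_nat (Suc k) ^ 2) = (\<Prod>i = 1..Suc k. ?x ^ 2 - of_nat i ^ 2)"
      by simp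
    finally show ?case .
  qed simp
  from this[of h] show ?thesis by (simp add: field_simps)
qed

text \<open>In \<open>hyp_sum_half\<close> with N = 2h the middle term m = h has denominator n and
  is factored out; it accounts for the leading 1 in the last factor.\<close>

lemma hyp_sum_odd:
  fixes h :: nat and n :: rat
  defines "n \<equiv> of_nat (2 * h + 1)"
  shows "(\<Sum>k<2 * h + 1. of_nat (3 * k + 1) * pochhammer (1/2 :: rat) k ^ 3 / pochhammer 1 k ^ 3 * 4 ^ k) =
    n * (\<Prod>i = 1..h. 1 - (n / of_nat i) ^ 2 / 4) ^ 2 *
    (1 - (\<Sum>j = 1..h. 2 * n ^ 2 / (4 * of_nat j ^ 2 - n ^ 2) * (\<Prod>a\<in>odds j. (n - of_nat a) / (n + of_nat a)) ^ 2))"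
proof -
  define b where "b m = (of_nat ((2 * h) choose m) :: rat)" for m
  have b0: "b h \<noteq> 0" by (simp add: b_def)
  have n0: "n \<noteq> 0" unfolding n_def by (simp del: of_nat_Suc of_nat_add)
  \<comment> \<open>Taking -i^2 out of each factor (n/2)^2 - i^2 produces h!^2, which cancels
    against the central binomial. The sign (-1)^h disappears when P is squared.\<close>
  have P: "2 * pochhammer (1/2) (2 * h + 1) / fact (2 * h) * b h =
      n * (-1) ^ h * (\<Prod>i = 1..h. 1 - (n / of_nat i) ^ 2 / 4)"
  proof -
    have "(\<Prod>i = 1..h. (n / 2) ^ 2 - of_nat i ^ 2) =
        (\<Prod>i = 1..h. of_nat i * of_nat i * ((-1) * (1 - (n / of_nat i) ^ 2 / 4)))"
      by (intro prod.cong refl) (simp add: field_simps power2_eq_square)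
    then have "(\<Prod>i = 1..h. (n / 2) ^ 2 - of_nat i ^ 2) = fact h * fact h * ((-1) ^ h * (\<Prod>i = 1..h. 1 - (n / of_nat i) ^ 2 / 4))"
      by (simp only: prod.distrib) (simp add: fact_prod)
    moreover have "b h = fact (2 * h) / (fact h * fact h)"
      by (simp add: b_def binomial_fact mult_2)
    ultimately show ?thesis
      unfolding pochhammer_half_odd n_def[symmetric] by simp
  qed
  have c: "b (h + j) = b h * (\<Prod>a\<in>odds j. (n - of_nat a) / (n + of_nat a))" if "j \<le> h" for j
    using binomial_ratio[OF that] b0 by (simp add: b_def n_def field_simps)
  have c': "b (h - j) = b (h + j)" if "j \<le> h" for j
    using that binomial_symmetric[of "h + j" "2 * h"] by (simp add: b_def mult_2)
  \<comment> \<open>The squared binomials at h+j and h-j coincide, so only 1/(n+2j) + 1/(n-2j) has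
    to be combined.\<close>
  have pair: "b (h + j) ^ 2 / of_nat (2 * (h + j) + 1) + b (h - j) ^ 2 / of_nat (2 * (h - j) + 1) =
     b h ^ 2 / n * - (2 * n ^ 2 / (4 * of_nat j ^ 2 - n ^ 2) * (\<Prod>a\<in>odds j. (n - of_nat a) / (n + of_nat a)) ^ 2)"
    if j: "j \<in> {1..h}" for j
  proof -
    have 1: "of_nat (2 * (h + j) + 1) = n + 2 * of_nat j" by (simp add: n_def)
    have 2: "of_nat (2 * (h - j) + 1) = n - 2 * of_nat j" using j by (simp add: n_def of_nat_diff)
    have p1: "n + 2 * of_nat j \<noteq> 0" unfolding 1[symmetric] of_nat_eq_0_iff by simp
    have p2: "n - 2 * of_nat j \<noteq> 0" unfolding 2[symmetric] of_nat_eq_0_iff by simp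
    have p3: "4 * of_nat j ^ 2 - n ^ 2 = - ((n + 2 * of_nat j) * (n - 2 * of_nat j))"
      by (simp add: algebra_simps power2_eq_square)
    have "X / (n + 2 * of_nat j) + X / (n - 2 * of_nat j) = X / n * - (2 * n ^ 2 / (4 * of_nat j ^ 2 - n ^ 2))" for X
      unfolding p3 using p1 p2 n0 by (simp add: divide_simps power2_eq_square) (simp add: algebra_simps)
    then show ?thesis
      unfolding 1 2 using j by (simp add: c' c power_mult_distrib)
  qed
  have "(\<Sum>k<2 * h + 1. of_nat (3 * k + 1) * pochhammer (1/2 :: rat) k ^ 3 / pochhammer 1 k ^ 3 * 4 ^ k) =
     4 * pochhammer (1/2) (2 * h + 1) ^ 2 / fact (2 * h) ^ 2 * (\<Sum>m\<le>2 * h. b m ^ 2 / of_nat (2 * m + 1))"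
    using hyp_sum_half[of "2 * h"] by (simp add: b_def)
  also have "(\<Sum>m\<le>2 * h. b m ^ 2 / of_nat (2 * m + 1)) = b h ^ 2 / n *
    (1 - (\<Sum>j = 1..h. 2 * n ^ 2 / (4 * of_nat j ^ 2 - n ^ 2) * (\<Prod>a\<in>odds j. (n - of_nat a) / (n + of_nat a)) ^ 2))"
    unfolding sum_atMost_symmetric
    by (simp only: pair sum_distrib_left[symmetric] sum_negf cong: sum.cong)
      (simp only: n_def algebra_simps mult_1_right)
  also have "4 * pochhammer (1/2) (2 * h + 1) ^ 2 / fact (2 * h) ^ 2 * (b h ^ 2 / n * X) =
    (2 * pochhammer (1/2) (2 * h + 1) / fact (2 * h) * b h) ^ 2 / n * X" for X
    by (simp add: power_mult_distrib power_divide)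
  finally show ?thesis unfolding P using n0
    by (simp add: power_mult_distrib power2_eq_square flip: power_mult)
qed

section \<open>Congruences between rational numbers\<close>

locale large_prime =
  fixes p :: nat
  assumes prime_p: "prime p" and p_gt_3: "p > 3"
begin

text \<open>\<open>pdiv m q\<close> says that \<open>q\<close> lies in the ideal \<open>p\<^sup>m \<int>\<^sub>(\<^sub>p\<^sub>)\<close>.\<close>
definition pdiv :: "nat \<Rightarrow> rat \<Rightarrow> bool" where
  "pdiv m q \<longleftrightarrow> (\<exists>x y :: int. \<not> int p dvd y \<and> q * of_int y = of_int (int p ^ m * x))"

lemma prime_int: "prime (int p)" using prime_p by simp

lemma p_odd: "odd p" using prime_p p_gt_3 prime_odd_nat by auto

lemma pdivI: "\<not> int p dvd y \<Longrightarrow> q * of_int y = of_int (int p ^ m * x) \<Longrightarrow> pdiv m q"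
  unfolding pdiv_def by blast

lemma pdiv_0 [simp]: "pdiv m 0"
  by (rule pdivI[of 1 _ _ 0]) (use prime_int in auto)

lemma pdiv_add:
  assumes "pdiv m a" "pdiv m b"
  shows "pdiv m (a + b)"
proof -
  obtain x y where 1: "\<not> int p dvd y" "a * of_int y = of_int (int p ^ m * x)" using assms(1) unfolding pdiv_def by blast
  obtain u v where 2: "\<not> int p dvd v" "b * of_int v = of_int (int p ^ m * u)" using assms(2) unfolding pdiv_def by blast
  have "(a + b) * of_int (y * v) = (a * of_int y) * of_int v + (b * of_int v) * of_int y" by (simp add: algebra_simps)
  also have "\<dots> = of_int (int p ^ m * (x * v + u * y))" unfolding 1 2 by (simp add: algebra_simps)
  finally show ?thesis
    by (rule pdivI[rotated]) (use 1(1) 2(1) prime_int in \<open>simp add: prime_dvd_mult_iff\<close>)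
qed

lemma pdiv_mult:
  assumes "pdiv k a" "pdiv m b"
  shows "pdiv (k + m) (a * b)"
proof -
  obtain x y where 1: "\<not> int p dvd y" "a * of_int y = of_int (int p ^ k * x)" using assms(1) unfolding pdiv_def by blast
  obtain u v where 2: "\<not> int p dvd v" "b * of_int v = of_int (int p ^ m * u)" using assms(2) unfolding pdiv_def by blast
  have "(a * b) * of_int (y * v) = (a * of_int y) * (b * of_int v)" by (simp add: algebra_simps)
  also have "\<dots> = of_int (int p ^ (k + m) * (x * u))" unfolding 1 2 by (simp add: power_add)
  finally show ?thesis
    by (rule pdivI[rotated]) (use 1(1) 2(1) prime_int in \<open>simp add: prime_dvd_mult_iff\<close>)
qed

lemma pdiv_mono:
  assumes "pdiv m a" "k \<le> m"
  shows "pdiv k a"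
proof -
  obtain x y where 1: "\<not> int p dvd y" "a * of_int y = of_int (int p ^ m * x)" using assms(1) unfolding pdiv_def by blast
  have "int p ^ m * x = int p ^ k * (int p ^ (m - k) * x)" using assms(2) by (simp flip: power_add mult.assoc)
  with 1(2) show ?thesis by (intro pdivI[OF 1(1)]) (simp only:)
qed

lemma pdiv_of_int [simp]: "pdiv 0 (of_int x)"
  by (rule pdivI[of 1 _ _ x]) (use prime_int in auto)

lemma pdiv_of_nat [simp]: "pdiv 0 (of_nat x)"
  using pdiv_of_int[of "int x"] by simp

lemma pdiv_numeral [simp]: "pdiv 0 (numeral x)" "pdiv 0 1"
  using pdiv_of_nat[of "numeral x"] pdiv_of_nat[of 1] by simp_all

lemma pdiv_p_power: "pdiv m (of_nat p ^ m)"
  by (rule pdivI[of 1 _ _ 1]) (use prime_int in auto)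

lemma pdiv_uminus: "pdiv m a \<Longrightarrow> pdiv m (- a)"
  using pdiv_mult[of 0 "-1" m a] pdiv_of_int[of "-1"] by simp

lemma pdiv_uminus_iff [simp]: "pdiv m (- a) \<longleftrightarrow> pdiv m a"
  using pdiv_uminus[of m a] pdiv_uminus[of m "-a"] by auto

lemma pdiv_diff: "pdiv m a \<Longrightarrow> pdiv m b \<Longrightarrow> pdiv m (a - b)"
  using pdiv_add[of m a "-b"] pdiv_uminus by simp

lemma pdiv_sum: "(\<And>i. i \<in> A \<Longrightarrow> pdiv m (f i)) \<Longrightarrow> pdiv m (\<Sum>i\<in>A. f i)"
  by (induction A rule: infinite_finite_induct) (simp_all add: pdiv_add)

lemma pdiv_mult_int: "pdiv 0 a \<Longrightarrow> pdiv m b \<Longrightarrow> pdiv m (a * b)" "pdiv m a \<Longrightarrow> pdiv 0 b \<Longrightarrow> pdiv m (a * b)"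
  using pdiv_mult[of 0 a m b] pdiv_mult[of m a 0 b] by simp_all

lemma pdiv_prod: "(\<And>i. i \<in> A \<Longrightarrow> pdiv 0 (f i)) \<Longrightarrow> pdiv 0 (\<Prod>i\<in>A. f i)"
  by (induction A rule: infinite_finite_induct) (simp_all add: pdiv_mult_int)

lemma pdiv_power: "pdiv m a \<Longrightarrow> pdiv (m * k) (a ^ k)"
  by (induction k) (use pdiv_mult in auto)

lemma pdiv_0_power [simp]: "pdiv 0 a \<Longrightarrow> pdiv 0 (a ^ k)"
  using pdiv_power[of 0] by simp

lemma pdiv_inverse_of_int: "\<not> int p dvd y \<Longrightarrow> pdiv 0 (1 / of_int y)"
  by (rule pdivI[of y _ _ 1]) auto

lemma pdiv_inverse_of_nat: "\<not> p dvd y \<Longrightarrow> pdiv 0 (1 / of_nat y)"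
  using pdiv_inverse_of_int[of "int y"] by simp

lemma pdiv_inverse_less: "0 < y \<Longrightarrow> y < p \<Longrightarrow> pdiv 0 (1 / of_nat y)"
  by (rule pdiv_inverse_of_nat) (auto dest: dvd_imp_le)

text \<open>Since p > 3, the constants 2, 3, 4, 6 and 8 that occur as denominators are units modulo
  p.\<close>

lemma not_dvd_powers: "\<not> p dvd 2 ^ i * 3 ^ j"
proof
  assume "p dvd 2 ^ i * 3 ^ j"
  then have "p dvd 2 \<or> p dvd 3" using prime_p by (meson prime_dvd_mult_iff prime_dvd_power)
  then show False using p_gt_3 by (auto dest: dvd_imp_le)
qed

lemma pdiv_inverse_numeral [simp]: "pdiv 0 (1 / 2)" "pdiv 0 (1 / 3)" "pdiv 0 (1 / 4)" "pdiv 0 (1 / 6)" "pdiv 0 (1 / 8)"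
  using pdiv_inverse_of_nat[OF not_dvd_powers[of 1 0]] pdiv_inverse_of_nat[OF not_dvd_powers[of 0 1]]
    pdiv_inverse_of_nat[OF not_dvd_powers[of 2 0]] pdiv_inverse_of_nat[OF not_dvd_powers[of 1 1]]
    pdiv_inverse_of_nat[OF not_dvd_powers[of 3 0]] by simp_all

lemma pdiv_inverse_one_plus:
  assumes "pdiv 1 x"
  shows "pdiv 0 (1 / (1 + x))"
proof -
  obtain u y where 1: "\<not> int p dvd y" "x * of_int y = of_int (int p * u)" using assms unfolding pdiv_def by auto
  have nd: "\<not> int p dvd y + int p * u" using 1(1) by (simp add: dvd_add_left_iff)
  then have "y + int p * u \<noteq> 0" by auto
  then have nz: "of_int (y + int p * u) \<noteq> (0::rat)" by (simp only: of_int_eq_0_iff not_False_eq_True)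
  have e: "(1 + x) * of_int y = of_int (y + int p * u)" using 1(2) by (simp add: algebra_simps)
  with nz have "1 + x \<noteq> 0" by auto
  then have "1 / (1 + x) * of_int (y + int p * u) = of_int y" unfolding e[symmetric] by simp
  then show ?thesis using nd by (intro pdivI[of "y + int p * u" _ _ y]) auto
qed

section \<open>Congruence modulo p^m as an equivalence relation\<close>

definition eqm :: "nat \<Rightarrow> rat \<Rightarrow> rat \<Rightarrow> bool" where
  "eqm m a b \<longleftrightarrow> pdiv m (a - b)"

lemma eqm_refl [simp]: "eqm m a a" by (simp add: eqm_def)

lemma eqm_sym: "eqm m a b \<Longrightarrow> eqm m b a"
  unfolding eqm_def by (metis minus_diff_eq pdiv_uminus)

lemma eqm_trans [trans]: "eqm m a b \<Longrightarrow> eqm m b c \<Longrightarrow> eqm m a c"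
  unfolding eqm_def using pdiv_add[of m "a - b" "b - c"] by simp

lemma eqm_add: "eqm m a b \<Longrightarrow> eqm m c d \<Longrightarrow> eqm m (a + c) (b + d)"
  unfolding eqm_def using pdiv_add[of m "a - b" "c - d"] by (simp add: algebra_simps)

lemma eqm_diff: "eqm m a b \<Longrightarrow> eqm m c d \<Longrightarrow> eqm m (a - c) (b - d)"
  unfolding eqm_def using pdiv_diff[of m "a - b" "c - d"] by (simp add: algebra_simps)

lemma eqm_sum: "(\<And>i. i \<in> A \<Longrightarrow> eqm m (f i) (g i)) \<Longrightarrow> eqm m (\<Sum>i\<in>A. f i) (\<Sum>i\<in>A. g i)"
  unfolding eqm_def sum_subtractf[symmetric] by (rule pdiv_sum)

lemma eqm_scale: "eqm m a b \<Longrightarrow> pdiv k c \<Longrightarrow> eqm (k + m) (c * a) (c * b)"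
  unfolding eqm_def right_diff_distrib[symmetric] by (rule pdiv_mult)

lemma eqm_scale0: "eqm m a b \<Longrightarrow> pdiv 0 c \<Longrightarrow> eqm m (c * a) (c * b)"
  using eqm_scale[of m a b 0 c] by simp

lemma eqm_mult:
  assumes "eqm m a b" "eqm m c d" "pdiv 0 a" "pdiv 0 d"
  shows "eqm m (a * c) (b * d)"
proof -
  have "a * c - b * d = a * (c - d) + (a - b) * d" by (simp add: algebra_simps)
  then show ?thesis using assms unfolding eqm_def by (metis pdiv_add pdiv_mult_int)
qed

lemma eqm_mono: "eqm m a b \<Longrightarrow> k \<le> m \<Longrightarrow> eqm k a b"
  unfolding eqm_def by (rule pdiv_mono)

lemma eqm_0_iff: "eqm m a 0 \<longleftrightarrow> pdiv m a"
  by (simp add: eqm_def)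

lemma eqm_pdiv: "eqm m a b \<Longrightarrow> pdiv m a \<Longrightarrow> pdiv m b"
  unfolding eqm_def using pdiv_diff[of m a "a - b"] by simp


text \<open>The denominator in lowest terms divides any other denominator y of the same fraction,
  and p does not divide y.\<close>

lemma pdiv_imp_rat_cong:
  assumes "pdiv m (a - b)"
  shows "rat_cong a b p m"
proof -
  obtain x y where 1: "\<not> int p dvd y" "(a - b) * of_int y = of_int (int p ^ m * x)"
    using assms unfolding pdiv_def by blast
  have p0: "(of_nat p :: rat) \<noteq> 0" using p_gt_3 by simp
  have "y \<noteq> 0" using 1(1) by auto
  with 1(2) p0 have q: "(a - b) / of_nat (p ^ m) = Fract x y"
    by (simp add: Fract_of_int_quotient field_simps)
  obtain c d where cd: "quotient_of ((a - b) / of_nat (p ^ m)) = (c, d)" by fastforce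
  then have "Fract x y = Fract c d" "d > 0" "coprime c d"
    using q quotient_of_div quotient_of_denom_pos quotient_of_coprime by (auto simp: Fract_of_int_quotient)
  then have "x * d = c * y" using \<open>y \<noteq> 0\<close> by (simp add: eq_rat)
  then have "d dvd c * y" by (metis dvd_triv_right)
  then have "d dvd y" using \<open>coprime c d\<close> by (simp add: coprime_commute coprime_dvd_mult_right_iff)
  then show ?thesis using 1(1) cd dvd_trans unfolding rat_cong_def by auto
qed

text \<open>Every product of two of the u i already lies in the ideal of p^(2m).\<close>

lemma prod_one_minus:
  assumes "finite A" "\<And>i. i \<in> A \<Longrightarrow> pdiv m (u i)"
  shows "eqm (2 * m) (\<Prod>i\<in>A. 1 - u i) (1 - (\<Sum>i\<in>A. u i))"
  using assms
proof (induction A)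
  case (insert x A)
  have "pdiv m (u x)" "pdiv m (\<Sum>i\<in>A. u i)" using insert.prems by (auto intro: pdiv_sum)
  then have *: "pdiv (2 * m) (u x * (\<Sum>i\<in>A. u i))" using pdiv_mult[of m _ m] by (simp add: mult_2)
  have "pdiv 0 (1 - u x)" using insert.prems pdiv_mono[of m "u x" 0] by (auto intro: pdiv_diff)
  then have "eqm (2 * m) ((1 - u x) * (\<Prod>i\<in>A. 1 - u i)) ((1 - u x) * (1 - (\<Sum>i\<in>A. u i)))"
    using insert by (intro eqm_scale0) auto
  also have "eqm (2 * m) \<dots> (1 - (u x + (\<Sum>i\<in>A. u i)))"
    using * by (simp add: eqm_def algebra_simps)
  finally show ?case using insert by simp
qed simp

end

section \<open>Reduction from prime powers to primes\<close>

lemma sum_split_multiples: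
  fixes f :: "nat \<Rightarrow> 'a::comm_monoid_add"
  assumes "finite A" and "q > 0" and "\<And>j. q * j \<in> A \<longleftrightarrow> j \<in> B"
  shows "sum f A = (\<Sum>j\<in>B. f (q * j)) + sum f {a \<in> A. \<not> q dvd a}"
proof -
  have "{a \<in> A. q dvd a} = (\<lambda>j. q * j) ` B" using assms(3) by (auto simp: dvd_def)
  then have "sum f {a \<in> A. q dvd a} = (\<Sum>j\<in>B. f (q * j))"
    using assms(2) by (simp add: sum.reindex inj_on_def)
  moreover have "sum f A = sum f ({a \<in> A. q dvd a} \<union> {a \<in> A. \<not> q dvd a})"
    by (rule arg_cong[of _ _ "sum f"]) auto
  ultimately show ?thesis using assms(1) by (simp add: sum.union_disjoint disjoint_iff)
qed

context large_prime
begin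

text \<open>Write i = p^e u with u prime to p. Then e <= s, and p^r / i = p^(r-e) / u with r - e >=
  m.\<close>

lemma pdiv_power_ratio:
  assumes "\<not> p ^ Suc s dvd i" "s + m \<le> r"
  shows "pdiv m (of_nat (p ^ r) / of_nat i)"
proof -
  have "i \<noteq> 0" using assms(1) by (metis dvd_0_right)
  moreover have "\<not> is_unit p" using p_gt_3 by simp
  ultimately obtain u where u: "i = p ^ multiplicity p i * u" "\<not> p dvd u"
    using multiplicity_decompose' by blast
  define e where "e = multiplicity p i"
  have "e \<le> s" using assms(1) u(1) unfolding e_def
    by (metis dvd_triv_left le_imp_power_dvd dvd_trans not_less_eq_eq)
  then have "p ^ r = p ^ e * p ^ (r - e)" "r - e \<ge> m" using assms(2) by (simp_all flip: power_add)
  moreover have "(of_nat (p ^ e) :: rat) \<noteq> 0" using p_gt_3 by simp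
  moreover have "(of_nat i :: rat) = of_nat (p ^ e) * of_nat u"
    by (subst u(1)) (simp add: e_def)
  ultimately have "of_nat (p ^ r) / of_nat i = of_nat p ^ (r - e) * (1 / of_nat u :: rat)"
    by (simp only: of_nat_mult of_nat_power mult_divide_mult_cancel_left) (use p_gt_3 in simp)
  moreover have "pdiv (r - e) (of_nat p ^ (r - e) * (1 / of_nat u))"
    by (rule pdiv_mult_int(2)[OF pdiv_p_power pdiv_inverse_of_nat[OF u(2)]])
  ultimately show ?thesis using pdiv_mono \<open>r - e \<ge> m\<close> by metis
qed

lemma pdiv_power_ratio_less:
  assumes "0 < i" "i < p ^ r"
  shows "pdiv 1 (of_nat (p ^ r) / of_nat i)"
proof (rule pdiv_power_ratio)
  have "r > 0" using assms by (cases r) auto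
  then show "r - 1 + 1 \<le> r" by simp
  show "\<not> p ^ Suc (r - 1) dvd i" using assms \<open>r > 0\<close> by (auto dest: dvd_imp_le)
qed

lemma pdiv_power_ratio_nondvd:
  assumes "\<not> p ^ (r - 1) dvd i"
  shows "pdiv 2 (of_nat (p ^ r) / of_nat i)"
proof (cases "r \<ge> 2")
  case True
  then have "Suc (r - 2) = r - 1" by simp
  then have "\<not> p ^ Suc (r - 2) dvd i" using assms by (simp only: not_False_eq_True)
  then show ?thesis by (rule pdiv_power_ratio) (use True in simp)
next
  case False
  \<comment> \<open>Here p^(r-1) = 1 divides every i, against the assumption.\<close>
  then have "r - 1 = 0" by simp
  then show ?thesis using assms by simp
qed

lemma pdiv_divide_power2: "pdiv m a \<Longrightarrow> pdiv m (a / 2)" "pdiv m a \<Longrightarrow> pdiv m (a / 4)" "pdiv m a \<Longrightarrow> pdiv m (a / 8)"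
  using pdiv_mult_int(2)[of m a "1/2"] pdiv_mult_int(2)[of m a "1/4"] pdiv_mult_int(2)[of m a "1/8"] by simp_all

text \<open>With y = n/a divisible by p, (n-a)/(n+a) = -(1-v) where v = 2y/(1+y) is 2y modulo p^2.
  Squaring removes the sign and doubles the linear term.\<close>

lemma odd_ratio_prod:
  assumes "p ^ r = 2 * h + 1" "j \<le> h"
  defines "n \<equiv> of_nat (p ^ r)"
  shows "eqm 2 ((\<Prod>a\<in>odds j. (n - of_nat a) / (n + of_nat a)) ^ 2) (1 - 4 * (\<Sum>a\<in>odds j. n / of_nat a))"
    and "pdiv 1 (\<Sum>a\<in>odds j. n / of_nat a)"
proof -
  define y where "y a = n / of_nat a" for a
  define v where "v a = 2 * y a * (1 / (1 + y a))" for a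
  have y: "pdiv 1 (y a)" if "a \<in> odds j" for a
    unfolding y_def n_def by (rule pdiv_power_ratio_less) (use that assms in \<open>auto simp: odds_def elim: oddE\<close>)
  have i: "pdiv 0 (1 / (1 + y a))" if "a \<in> odds j" for a
    using y[OF that] by (rule pdiv_inverse_one_plus)
  have v: "pdiv 1 (v a)" if "a \<in> odds j" for a
    unfolding v_def by (intro pdiv_mult_int(2)[OF _ i[OF that]] pdiv_mult_int(1)[OF _ y[OF that]]) simp
  have vy: "eqm 2 (v a) (2 * y a)" if a: "a \<in> odds j" for a
  proof -
    have "n \<ge> 0" "a > 0" using a by (auto simp: n_def odds_def elim: oddE)
    then have "1 + y a \<noteq> 0" by (simp add: y_def add_pos_nonneg order_less_imp_not_eq2)
    then have "v a - 2 * y a = - (2 * (y a * y a)) * (1 / (1 + y a))"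
      by (simp add: v_def field_simps)
    moreover have "pdiv 2 (y a * y a)" using pdiv_mult[OF y[OF a] y[OF a]] by (simp add: numeral_2_eq_2)
    then have "pdiv 2 (- (2 * (y a * y a)))" using pdiv_mult_int(1)[OF pdiv_numeral(1)] by simp
    ultimately show ?thesis using i[OF a] by (simp only: eqm_def pdiv_mult_int(2))
  qed
  have Y: "pdiv 1 (\<Sum>a\<in>odds j. y a)" using y by (rule pdiv_sum)
  then show "pdiv 1 (\<Sum>a\<in>odds j. n / of_nat a)" by (simp add: y_def)
  have "((n - of_nat a) / (n + of_nat a)) ^ 2 = (1 - v a) ^ 2" if a: "a \<in> odds j" for a
  proof -
    have "n \<ge> 0" "a > 0" using a by (auto simp: n_def odds_def elim: oddE)
    then have "n + of_nat a \<noteq> 0" by (simp add: add_nonneg_pos order_less_imp_not_eq2)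
    then have "(n - of_nat a) / (n + of_nat a) = - (1 - v a)" using \<open>a > 0\<close>
      by (simp add: v_def y_def divide_simps add.commute)
    then show ?thesis by (simp only: power2_minus)
  qed
  then have "(\<Prod>a\<in>odds j. (n - of_nat a) / (n + of_nat a)) ^ 2 = (\<Prod>a\<in>odds j. 1 - v a) ^ 2"
    unfolding prod_power_distrib by (rule prod.cong[OF refl])
  moreover have "eqm 2 (\<Prod>a\<in>odds j. 1 - v a) (1 - 2 * (\<Sum>a\<in>odds j. y a))"
  proof -
    have "eqm 2 (\<Prod>a\<in>odds j. 1 - v a) (1 - (\<Sum>a\<in>odds j. v a))"
      using prod_one_minus[of "odds j" 1 v] v by simp
    also have "eqm 2 \<dots> (1 - (\<Sum>a\<in>odds j. 2 * y a))"
      by (intro eqm_diff eqm_refl eqm_sum vy)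
    finally show ?thesis by (simp add: sum_distrib_left)
  qed
  moreover have "pdiv 0 (\<Sum>a\<in>odds j. y a)" using pdiv_mono[OF Y] by simp
  then have "pdiv 0 (1 - 2 * (\<Sum>a\<in>odds j. y a))" by (intro pdiv_diff pdiv_mult_int) simp_all
  moreover have "pdiv 0 (\<Prod>a\<in>odds j. 1 - v a)"
    using pdiv_mono[OF v] by (intro pdiv_prod pdiv_diff) simp_all
  ultimately have "eqm 2 ((\<Prod>a\<in>odds j. (n - of_nat a) / (n + of_nat a)) ^ 2) ((1 - 2 * (\<Sum>a\<in>odds j. y a)) ^ 2)"
    unfolding power2_eq_square by (simp add: eqm_mult)
  also have "eqm 2 \<dots> (1 - 4 * (\<Sum>a\<in>odds j. y a))"
  proof -
    have "pdiv 2 (4 * ((\<Sum>a\<in>odds j. y a) * (\<Sum>a\<in>odds j. y a)))"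
      using pdiv_mult_int(1)[OF pdiv_numeral(1) pdiv_mult[OF Y Y]] by (simp add: numeral_2_eq_2)
    then show ?thesis by (simp add: eqm_def power2_eq_square algebra_simps)
  qed
  finally show "eqm 2 ((\<Prod>a\<in>odds j. (n - of_nat a) / (n + of_nat a)) ^ 2) (1 - 4 * (\<Sum>a\<in>odds j. n / of_nat a))"
    by (simp add: y_def)
qed

text \<open>All x i = (n/i)^2 are divisible by p^2, so modulo p^4 the two factors are 1 - V and 1 -
  T, and the product V T vanishes.\<close>

lemma hyp_sum_quotient_eqm:
  assumes "p ^ r = 2 * h + 1"
  defines "n \<equiv> of_nat (p ^ r)"
  shows "eqm 4 ((\<Prod>i = 1..h. 1 - (n / of_nat i) ^ 2 / 4) ^ 2 *
      (1 - (\<Sum>j = 1..h. 2 * n ^ 2 / (4 * of_nat j ^ 2 - n ^ 2) * (\<Prod>a\<in>odds j. (n - of_nat a) / (n + of_nat a)) ^ 2)))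
    (1 + (\<Sum>j = 1..h. (n / of_nat j) ^ 2 * (2 * (\<Sum>a\<in>odds j. n / of_nat a) - 1)))"
proof -
  define x where "x i = (n / of_nat i) ^ 2" for i
  define Y where "Y j = (\<Sum>a\<in>odds j. n / of_nat a)" for j
  define c where "c j = (\<Prod>a\<in>odds j. (n - of_nat a) / (n + of_nat a)) ^ 2" for j
  define V where "V = (\<Sum>i = 1..h. x i / 2)"
  define T where "T = (\<Sum>j = 1..h. x j / 2 * (1 - 4 * Y j))"
  have x: "pdiv 2 (x i)" if "i \<in> {1..h}" for i
  proof -
    have "pdiv 1 (n / of_nat i)" unfolding n_def
      by (rule pdiv_power_ratio_less) (use that assms in auto)
    then show ?thesis using pdiv_power[of 1 _ 2] by (simp add: x_def)
  qed
  have Y: "pdiv 1 (Y j)" and c: "eqm 2 (c j) (1 - 4 * Y j)" if "j \<in> {1..h}" for j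
    using odd_ratio_prod[OF assms(1), of j] that by (simp_all add: Y_def c_def n_def)
  have Y0: "pdiv 0 (1 - 4 * Y j)" if "j \<in> {1..h}" for j
    using pdiv_mono[OF Y[OF that]] by (intro pdiv_diff pdiv_mult_int) simp_all
  have c0: "pdiv 0 (c j)" if "j \<in> {1..h}" for j
    using eqm_pdiv[OF eqm_sym[OF eqm_mono[OF c[OF that]]] Y0[OF that]] by simp
  have V: "pdiv 2 V" unfolding V_def by (intro pdiv_sum pdiv_divide_power2 x)
  have T: "pdiv 2 T" unfolding T_def by (intro pdiv_sum pdiv_mult_int(2) pdiv_divide_power2 x Y0)
  have 1: "eqm 4 ((\<Prod>i = 1..h. 1 - x i / 4) ^ 2) (1 - V)"
  proof -
    define U where "U = (\<Sum>i = 1..h. x i / 4)"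
    have U: "pdiv 2 U" unfolding U_def by (intro pdiv_sum pdiv_divide_power2 x)
    have 1: "eqm 4 (\<Prod>i = 1..h. 1 - x i / 4) (1 - U)"
      using prod_one_minus[of "{1..h}" 2 "\<lambda>i. x i / 4"] pdiv_divide_power2(2)[OF x] by (simp add: U_def)
    have U0: "pdiv 0 (1 - U)" using pdiv_mono[OF U] by (intro pdiv_diff) simp_all
    have "eqm 4 ((\<Prod>i = 1..h. 1 - x i / 4) * (\<Prod>i = 1..h. 1 - x i / 4)) ((1 - U) * (1 - U))"
      using eqm_mult[OF 1 1 _ U0] eqm_pdiv[OF eqm_sym[OF eqm_mono[OF 1]] U0] by simp
    also have "eqm 4 \<dots> (1 - V)"
    proof -
      have "V = 2 * U" by (simp add: V_def U_def sum_distrib_left)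
      then have "(1 - U) * (1 - U) - (1 - V) = U * U" by (simp add: algebra_simps)
      then show ?thesis using pdiv_mult[OF U U] by (simp add: eqm_def)
    qed
    finally show ?thesis by (simp add: power2_eq_square)
  qed
  \<comment> \<open>The fraction equals (x/2)/(1 - x/4) with x = x j, which is x/2 up to a multiple
    of x^2. Since p^2 divides x, the factor c j matters only modulo p^2.\<close>
  have 2: "eqm 4 (2 * n ^ 2 / (4 * of_nat j ^ 2 - n ^ 2) * c j) (x j / 2 * (1 - 4 * Y j))" if j: "j \<in> {1..h}" for j
  proof -
    have "2 * j \<noteq> p ^ r" using assms(1) by presburger
    then have "of_nat (2 * j) \<noteq> n" unfolding n_def of_nat_eq_iff .
    moreover have "of_nat (2 * j) \<noteq> - n"
    proof -
      have "of_nat (2 * j) > (0::rat)" "- n \<le> 0" using j by (simp_all add: n_def)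
      then show ?thesis by linarith
    qed
    ultimately have "(of_nat (2 * j) - n) * (of_nat (2 * j) + n) \<noteq> 0" by (simp add: eq_neg_iff_add_eq_0)
    then have nz: "4 * of_nat j ^ 2 - n ^ 2 \<noteq> 0" by (simp add: power2_eq_square algebra_simps)
    have j0: "(of_nat j :: rat) \<noteq> 0" using j by simp
    have "1 + - (x j / 4) = (4 * of_nat j ^ 2 - n ^ 2) / (4 * of_nat j ^ 2)"
      using j0 by (simp add: x_def field_simps)
    then have "2 * n ^ 2 / (4 * of_nat j ^ 2 - n ^ 2) = x j / 2 * (1 / (1 + - (x j / 4)))"
      using j0 nz by (simp add: x_def field_simps)
    moreover have "1 + - (x j / 4) \<noteq> 0"
      using \<open>1 + - (x j / 4) = _\<close> nz j0 by simp
    moreover have "X / 2 * (1 / (1 + - (X / 4))) - X / 2 = X * X / 8 * (1 / (1 + - (X / 4)))"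
      if "1 + - (X / 4) \<noteq> 0" for X :: rat
      using that by (simp add: divide_simps) (simp add: algebra_simps)
    ultimately have "2 * n ^ 2 / (4 * of_nat j ^ 2 - n ^ 2) - x j / 2 = x j * x j / 8 * (1 / (1 + - (x j / 4)))"
      by (simp only: not_False_eq_True)
    moreover have "pdiv 4 (x j * x j / 8)" using pdiv_mult[OF x[OF j] x[OF j]] by (intro pdiv_divide_power2) simp
    moreover have "pdiv 0 (1 / (1 + - (x j / 4)))"
      using pdiv_mono[OF pdiv_divide_power2(2)[OF x[OF j]], of 1] by (intro pdiv_inverse_one_plus) simp
    ultimately have "eqm 4 (2 * n ^ 2 / (4 * of_nat j ^ 2 - n ^ 2)) (x j / 2)"
      by (simp only: eqm_def pdiv_mult_int(2))
    from eqm_scale0[OF this c0[OF j]]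
    have "eqm 4 (2 * n ^ 2 / (4 * of_nat j ^ 2 - n ^ 2) * c j) (x j / 2 * c j)" by (simp only: mult.commute)
    also have "eqm 4 \<dots> (x j / 2 * (1 - 4 * Y j))"
      using eqm_scale[OF c[OF j] pdiv_divide_power2(1)[OF x[OF j]]] by simp
    finally show ?thesis .
  qed
  have 3: "eqm 4 (1 - (\<Sum>j = 1..h. 2 * n ^ 2 / (4 * of_nat j ^ 2 - n ^ 2) * c j)) (1 - T)"
    unfolding T_def by (intro eqm_diff eqm_refl eqm_sum 2)
  have V0: "pdiv 0 (1 - V)" and T0: "pdiv 0 (1 - T)"
    using pdiv_mono[OF V] pdiv_mono[OF T] by (auto intro!: pdiv_diff)
  have "eqm 4 ((\<Prod>i = 1..h. 1 - x i / 4) ^ 2 * (1 - (\<Sum>j = 1..h. 2 * n ^ 2 / (4 * of_nat j ^ 2 - n ^ 2) * c j)))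
     ((1 - V) * (1 - T))"
    using eqm_mult[OF 1 3 _ T0] eqm_pdiv[OF eqm_sym[OF eqm_mono[OF 1]] V0] by simp
  also have "eqm 4 \<dots> (1 - V - T)"
    using pdiv_mult[OF V T] by (simp add: eqm_def algebra_simps)
  also have "1 - V - T = 1 + (\<Sum>j = 1..h. x j * (2 * Y j - 1))"
  proof -
    have "V + T = - (\<Sum>j = 1..h. x j * (2 * Y j - 1))"
      unfolding V_def T_def sum.distrib[symmetric] sum_negf[symmetric]
      by (intro sum.cong refl) (simp add: algebra_simps)
    then show ?thesis by simp
  qed
  finally show ?thesis by (simp only: x_def Y_def c_def)
qed

text \<open>Put q = p^(r-1). If q does not divide j, then p^2 divides n/j and the summand vanishes
  modulo p^4; for multiples, n/(q j) = p/j. The inner sums reduce in the same way, and modulo p^2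
  suffices there because p^2 divides (p/j)^2.\<close>

lemma reduce_to_prime:
  assumes "p ^ r = 2 * h + 1" "p = 2 * k + 1" "r > 0"
  shows "eqm 4 (\<Sum>j = 1..h. (of_nat (p ^ r) / of_nat j) ^ 2 * (2 * (\<Sum>a\<in>odds j. of_nat (p ^ r) / of_nat a) - 1))
     (\<Sum>j = 1..k. (of_nat p / of_nat j) ^ 2 * (2 * (\<Sum>a\<in>odds j. of_nat p / of_nat a) - 1))"
proof -
  define q where "q = p ^ (r - 1)"
  define n :: rat where "n = of_nat (p ^ r)"
  define Y where "Y j = (\<Sum>a\<in>odds j. n / of_nat a)" for j
  have pr: "p ^ r = q * p" using assms(3) by (cases r) (simp_all add: q_def)
  have q: "q > 0" "odd q" using p_gt_3 p_odd by (simp_all add: q_def)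
  have ratio: "n / of_nat (q * j) = of_nat p / of_nat j" for j
    using q unfolding n_def pr by simp
  have mem: "q * j \<in> {1..h} \<longleftrightarrow> j \<in> {1..k}" for j
  proof -
    have "q * j \<le> h \<longleftrightarrow> q * (2 * j) < q * p" using assms(1) pr by auto
    also have "\<dots> \<longleftrightarrow> 2 * j < p" using q by simp
    also have "\<dots> \<longleftrightarrow> j \<le> k" using assms(2) by auto
    finally show ?thesis using q by auto
  qed
  \<comment> \<open>As q is odd, multiplication by q preserves parity.\<close>
  have memo: "q * a \<in> odds (q * j) \<longleftrightarrow> a \<in> odds j" for a j
    using q by (auto simp: odds_def mult.left_commute[of 2 q])
  have Yq: "eqm 2 (Y (q * j)) (\<Sum>a\<in>odds j. of_nat p / of_nat a)" for j
  proof -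
    have "Y (q * j) - (\<Sum>a\<in>odds j. of_nat p / of_nat a) = (\<Sum>a | a \<in> odds (q * j) \<and> \<not> q dvd a. n / of_nat a)"
      unfolding Y_def using sum_split_multiples[OF finite_odds q(1) memo, of "\<lambda>a. n / of_nat a" j]
      by (simp only: ratio add_diff_cancel_left')
    moreover have "pdiv 2 \<dots>"
      unfolding n_def q_def by (intro pdiv_sum pdiv_power_ratio_nondvd) simp
    ultimately show ?thesis by (simp only: eqm_def)
  qed
  have Y: "pdiv 0 (2 * Y j - 1)" if "j \<in> {1..h}" for j
    using pdiv_mono[OF odd_ratio_prod(2)[OF assms(1)], of j] that
    by (intro pdiv_diff pdiv_mult_int) (simp_all add: Y_def n_def)
  have "eqm 4 (\<Sum>j = 1..h. (n / of_nat j) ^ 2 * (2 * Y j - 1))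
     (\<Sum>j = 1..k. (n / of_nat (q * j)) ^ 2 * (2 * Y (q * j) - 1))"
  proof -
    have "pdiv 4 (\<Sum>j | j \<in> {1..h} \<and> \<not> q dvd j. (n / of_nat j) ^ 2 * (2 * Y j - 1))"
    proof (rule pdiv_sum)
      fix j assume j: "j \<in> {j \<in> {1..h}. \<not> q dvd j}"
      then have "pdiv 2 (n / of_nat j)" unfolding n_def q_def by (intro pdiv_power_ratio_nondvd) simp
      then have "pdiv 4 ((n / of_nat j) ^ 2)" using pdiv_power[of 2 _ 2] by simp
      then show "pdiv 4 ((n / of_nat j) ^ 2 * (2 * Y j - 1))"
        using Y j by (intro pdiv_mult_int(2)) simp_all
    qed
    then show ?thesis
      unfolding sum_split_multiples[of "{1..h}", OF finite_atLeastAtMost q(1) mem] by (simp add: eqm_def)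
  qed
  also have "eqm 4 \<dots> (\<Sum>j = 1..k. (of_nat p / of_nat j) ^ 2 * (2 * (\<Sum>a\<in>odds j. of_nat p / of_nat a) - 1))"
  proof (rule eqm_sum)
    fix j assume j: "j \<in> {1..k}"
    then have "pdiv 1 (of_nat (p ^ 1) / of_nat j)" using assms(2) by (intro pdiv_power_ratio_less) auto
    then have "pdiv 2 ((of_nat p / of_nat j) ^ 2)" using pdiv_power[of 1 _ 2] by simp
    moreover have "eqm 2 (2 * Y (q * j) - 1) (2 * (\<Sum>a\<in>odds j. of_nat p / of_nat a) - 1)"
      by (intro eqm_diff eqm_scale0 Yq) simp_all
    ultimately show "eqm 4 ((n / of_nat (q * j)) ^ 2 * (2 * Y (q * j) - 1)) ((of_nat p / of_nat j) ^ 2 * (2 * (\<Sum>a\<in>odds j. of_nat p / of_nat a) - 1))"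
      unfolding ratio using eqm_scale by fastforce
  qed
  finally show ?thesis by (simp add: n_def Y_def)
qed

end

section \<open>Bernoulli numbers\<close>

lemma bernoulli_0: "bernoulli 0 = 1"
  by (simp add: bernoulli.simps)

lemma sum_bernoulli:
  assumes "n > 0"
  shows "(\<Sum>i\<le>n. of_nat (Suc n choose i) * bernoulli i) = 0"
proof -
  have "bernoulli n = - (\<Sum>k<n. of_nat (Suc n choose k) * bernoulli k) / of_nat (Suc n)"
    using assms by (subst bernoulli.simps) simp
  then have "of_nat (Suc n) * bernoulli n = - (\<Sum>k<n. of_nat (Suc n choose k) * bernoulli k)"
    by (simp del: of_nat_Suc)
  then show ?thesis by (simp add: lessThan_Suc_atMost[symmetric] del: of_nat_Suc binomial_Suc_Suc)
qed

text \<open>Induction on s: in the increment from s to s+1 the coefficient of s^l contains the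
  Bernoulli recurrence of order m - l, which vanishes unless l = m.\<close>

lemma faulhaber:
  "of_nat (Suc m) * (\<Sum>j<s. of_nat j ^ m) =
    (\<Sum>i\<le>m. of_nat (Suc m choose i) * bernoulli i * of_nat s ^ (Suc m - i))"
proof (induction s)
  case 0
  have "(\<Sum>i\<le>m. of_nat (Suc m choose i) * bernoulli i * 0 ^ (Suc m - i)) = 0"
    by (intro sum.neutral) (simp add: Suc_diff_le)
  then show ?case by (simp del: binomial_Suc_Suc)
next
  case (Suc s)
  let ?s = "of_nat s :: rat"
  have expand: "of_nat (Suc s) ^ (Suc m - i) = ?s ^ (Suc m - i) + (\<Sum>l\<le>m - i. of_nat (Suc m - i choose l) * ?s ^ l)"
    if "i \<le> m" for i
    using that binomial_ring[of ?s 1 "Suc m - i"] by (simp add: Suc_diff_le add.commute)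
  have "(\<Sum>i\<le>m. of_nat (Suc m choose i) * bernoulli i * of_nat (Suc s) ^ (Suc m - i)) =
      (\<Sum>i\<le>m. of_nat (Suc m choose i) * bernoulli i * ?s ^ (Suc m - i)) +
      (\<Sum>i\<le>m. \<Sum>l\<le>m - i. of_nat (Suc m choose i) * of_nat (Suc m - i choose l) * bernoulli i * ?s ^ l)"
    by (simp add: expand sum.distrib distrib_left sum_distrib_left mult_ac del: of_nat_Suc binomial_Suc_Suc)
  also have "(\<Sum>i\<le>m. \<Sum>l\<le>m - i. of_nat (Suc m choose i) * of_nat (Suc m - i choose l) * bernoulli i * ?s ^ l) =
      (\<Sum>l\<le>m. \<Sum>i\<le>m - l. of_nat (Suc m choose i) * of_nat (Suc m - i choose l) * bernoulli i * ?s ^ l)"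
    by (simp add: sum.Sigma, intro sum.reindex_bij_witness[of _ prod.swap prod.swap]) auto
  also have "\<dots> = (\<Sum>l\<le>m. of_nat (Suc m choose l) * ?s ^ l * (\<Sum>i\<le>m - l. of_nat (Suc (m - l) choose i) * bernoulli i))"
  proof (rule sum.cong[OF refl])
    fix l assume "l \<in> {..m}"
    then have l: "l \<le> m" by simp
    \<comment> \<open>Both sides count disjoint choices of i and l elements; this moves the factor
      depending on l out of the inner sum.\<close>
    have *: "(Suc m choose i) * (Suc m - i choose l) = (Suc m choose l) * (Suc (m - l) choose i)"
      if "i \<le> m - l" for i
    proof -
      have "(Suc m choose (i + l)) * (i + l choose i) = (Suc m choose i) * (Suc m - i choose l)"
        "(Suc m choose (i + l)) * (i + l choose l) = (Suc m choose l) * (Suc m - l choose i)"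
        using that l choose_mult[of i "i + l" "Suc m"] choose_mult[of l "i + l" "Suc m"] by simp_all
      moreover have "i + l choose i = i + l choose l" using binomial_symmetric[of i "i + l"] by simp
      moreover have "Suc m - l = Suc (m - l)" using l by simp
      ultimately show ?thesis by (simp only:)
    qed
    show "(\<Sum>i\<le>m - l. of_nat (Suc m choose i) * of_nat (Suc m - i choose l) * bernoulli i * ?s ^ l) =
      of_nat (Suc m choose l) * ?s ^ l * (\<Sum>i\<le>m - l. of_nat (Suc (m - l) choose i) * bernoulli i)"
      unfolding sum_distrib_left
    proof (rule sum.cong[OF refl])
      fix i assume "i \<in> {..m - l}"
      then have "of_nat (Suc m choose i) * of_nat (Suc m - i choose l) =
          of_nat (Suc m choose l) * (of_nat (Suc (m - l) choose i) :: rat)"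
        using * unfolding of_nat_mult[symmetric] of_nat_eq_iff by simp
      then show "of_nat (Suc m choose i) * of_nat (Suc m - i choose l) * bernoulli i * ?s ^ l =
        of_nat (Suc m choose l) * ?s ^ l * (of_nat (Suc (m - l) choose i) * bernoulli i)"
        by (simp only: mult_ac)
    qed
  qed
  also have "\<dots> = (\<Sum>l\<le>m. if l = m then of_nat (Suc m) * ?s ^ m else 0)"
    by (intro sum.cong refl) (auto simp: sum_bernoulli bernoulli_0 simp del: of_nat_Suc binomial_Suc_Suc)
  also have "\<dots> = of_nat (Suc m) * ?s ^ m" by simp
  finally show ?case by (simp add: Suc.IH[symmetric] distrib_left del: of_nat_Suc)
qed

section \<open>Power sums and Bernoulli numbers modulo p\<close>

context large_prime
begin

text \<open>The recurrence up to index i divides only by numbers at most i + 1, all below p.\<close>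

lemma pdiv_bernoulli: "i + 1 < p \<Longrightarrow> pdiv 0 (bernoulli i)"
proof (induction i rule: less_induct)
  case (less i)
  show ?case
  proof (cases "i = 0")
    case False
    have "pdiv 0 (\<Sum>k<i. of_nat (i + 1 choose k) * bernoulli k)"
      using less by (intro pdiv_sum pdiv_mult_int) auto
    moreover have "pdiv 0 (1 / of_nat (i + 1))" using less.prems by (intro pdiv_inverse_less) auto
    ultimately have "pdiv 0 (- ((\<Sum>k<i. of_nat (i + 1 choose k) * bernoulli k) * (1 / of_nat (i + 1))))"
      by (intro pdiv_uminus pdiv_mult_int)
    then show ?thesis using False by (subst bernoulli.simps) simp
  qed (simp add: bernoulli_0)
qed

text \<open>Every term of Faulhaber's formula at s = p contains p, and m + 1 < p is
  invertible.\<close>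

lemma pdiv_power_sum:
  assumes "0 < m" "m < p - 1"
  shows "pdiv 1 (\<Sum>j<p. of_nat j ^ m)"
proof -
  have "pdiv 1 (\<Sum>i\<le>m. of_nat (Suc m choose i) * bernoulli i * of_nat p ^ (Suc m - i))"
  proof (rule pdiv_sum, intro pdiv_mult_int(1) pdiv_of_nat)
    fix i assume "i \<in> {..m}"
    then show "pdiv 0 (bernoulli i)" "pdiv 1 (of_nat p ^ (Suc m - i))"
      using assms pdiv_mono[OF pdiv_p_power, of 1 "Suc m - i"] by (auto intro!: pdiv_bernoulli)
  qed
  then have "pdiv 1 (of_nat (Suc m) * (\<Sum>j<p. of_nat j ^ m) :: rat)" by (simp only: faulhaber)
  moreover have "pdiv 0 (1 / of_nat (Suc m))" using assms by (intro pdiv_inverse_less) auto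
  ultimately have "pdiv 1 (1 / of_nat (Suc m) * (of_nat (Suc m) * (\<Sum>j<p. of_nat j ^ m)))"
    by (rule pdiv_mult_int(1)[rotated])
  then show ?thesis by (simp del: of_nat_Suc)
qed

lemma eqm_fermat:
  assumes "0 < j" "j < p"
  shows "eqm 1 (of_nat j ^ (p - 1)) 1"
proof -
  have "\<not> p dvd j" using assms by (auto dest: dvd_imp_le)
  then have "[j ^ (p - 1) = 1] (mod p)" using fermat_theorem prime_p by blast
  then have "int p dvd int j ^ (p - 1) - 1"
    by (metis cong_iff_dvd_diff cong_int_iff of_nat_1 of_nat_power)
  then obtain x where "int j ^ (p - 1) - 1 = int p * x" by blast
  then have "of_int (int j ^ (p - 1) - 1) = (of_int (int p * x) :: rat)" by simp
  then show ?thesis unfolding eqm_def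
    by (intro pdivI[of 1 _ _ x]) (use prime_int in auto)
qed

lemma eqm_inverse_power:
  assumes "0 < j" "j < p" "m < p"
  shows "eqm 1 (1 / of_nat j ^ m) (of_nat j ^ (p - 1 - m))"
proof -
  have "pdiv 0 ((1 / of_nat j) ^ m)" using pdiv_inverse_less[OF assms(1,2)] by simp
  from eqm_scale0[OF eqm_sym[OF eqm_fermat[OF assms(1,2)]] this]
  have "eqm 1 (1 / of_nat j ^ m) (of_nat j ^ (p - 1) / of_nat j ^ m)" by (simp add: power_one_over)
  also have "(of_nat j ^ (p - 1) / of_nat j ^ m :: rat) = of_nat j ^ (p - 1 - m)"
    using assms by (subst power_diff) auto
  finally show ?thesis .
qed

text \<open>Fermat lowers the exponent by p - 1. Exponent 0 leaves p - 1 ones, that is -1; a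
  positive exponent falls under \<open>pdiv_power_sum\<close>.\<close>

lemma power_sum_eqm:
  assumes "p - 1 \<le> m" "m < 2 * (p - 1)"
  shows "eqm 1 (\<Sum>j = 1..<p. of_nat j ^ m) (if m = p - 1 then - 1 else 0)"
proof -
  have "eqm 1 (\<Sum>j = 1..<p. of_nat j ^ m) (\<Sum>j = 1..<p. of_nat j ^ (m - (p - 1)))"
  proof (rule eqm_sum)
    fix j assume "j \<in> {1..<p}"
    then have "eqm 1 (of_nat j ^ (m - (p - 1)) * of_nat j ^ (p - 1)) (of_nat j ^ (m - (p - 1)) * 1)"
      by (intro eqm_scale0 eqm_fermat) auto
    then show "eqm 1 (of_nat j ^ m) (of_nat j ^ (m - (p - 1)))" using assms by (simp flip: power_add)
  qed
  also have "eqm 1 \<dots> (if m = p - 1 then - 1 else 0)"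
  proof (cases "m = p - 1")
    case True
    then show ?thesis using p_gt_3 pdiv_p_power[of 1] by (simp add: eqm_def of_nat_diff)
  next
    case False
    have "{..<p} = insert 0 {1..<p}" using p_gt_3 by auto
    then have "(\<Sum>j<p. of_nat j ^ (m - (p - 1)) :: rat) = (\<Sum>j = 1..<p. of_nat j ^ (m - (p - 1)))"
      using assms False by (simp add: power_0_left)
    then show ?thesis using pdiv_power_sum[of "m - (p - 1)"] assms False by (simp add: eqm_def)
  qed
  finally show ?thesis .
qed

text \<open>Fermat turns 1/j and 1/s^2 into j^(p-2) and s^(p-3). After Faulhaber for the sum over j,
  the power sum over s survives only for exponent p - 1, which is i = p - 3.\<close>

lemma double_harmonic_bernoulli:
  "eqm 1 (\<Sum>s = 1..<p. \<Sum>j = 1..<s. 1 / of_nat j * (1 / of_nat s ^ 2)) (bernoulli (p - 3))"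
proof -
  have pm: "Suc (p - 2) = p - 1" using p_gt_3 by simp
  have inv: "pdiv 0 (1 / of_nat (p - 1))" using p_gt_3 by (intro pdiv_inverse_less) auto
  have B: "pdiv 0 (bernoulli i)" if "i \<in> {..p - 2}" for i using that p_gt_3 by (intro pdiv_bernoulli) auto
  have "eqm 1 (\<Sum>s = 1..<p. \<Sum>j = 1..<s. 1 / of_nat j * (1 / of_nat s ^ 2))
      (\<Sum>s = 1..<p. \<Sum>j = 1..<s. of_nat j ^ (p - 2) * of_nat s ^ (p - 3))"
  proof (intro eqm_sum)
    fix s j assume sj: "s \<in> {1..<p}" "j \<in> {1..<s}"
    have "eqm 1 (1 / of_nat j) (of_nat j ^ (p - 2))"
      using eqm_inverse_power[of j 1] sj by (simp add: numeral_2_eq_2)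
    moreover have "eqm 1 (1 / of_nat s ^ 2) (of_nat s ^ (p - 3))"
      using eqm_inverse_power[of s 2] sj p_gt_3 by (simp add: numeral_3_eq_3 numeral_2_eq_2)
    ultimately show "eqm 1 (1 / of_nat j * (1 / of_nat s ^ 2)) (of_nat j ^ (p - 2) * of_nat s ^ (p - 3))"
      using sj pdiv_inverse_less[of j] by (intro eqm_mult) auto
  qed
  also have "(\<Sum>s = 1..<p. \<Sum>j = 1..<s. of_nat j ^ (p - 2) * of_nat s ^ (p - 3)) =
     (\<Sum>s = 1..<p. of_nat s ^ (p - 3) * (1 / of_nat (p - 1)) *
       (\<Sum>i\<le>p - 2. of_nat (p - 1 choose i) * bernoulli i * of_nat s ^ (p - 1 - i)))"
  proof (rule sum.cong[OF refl])
    fix s assume "s \<in> {1..<p}"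
    then have "{..<s} = insert 0 {1..<s}" by auto
    then have "(\<Sum>j = 1..<s. of_nat j ^ (p - 2)) = (\<Sum>j<s. of_nat j ^ (p - 2) :: rat)"
      using p_gt_3 by (simp add: power_0_left)
    also have "\<dots> = 1 / of_nat (p - 1) * (of_nat (p - 1) * (\<Sum>j<s. of_nat j ^ (p - 2)))" using p_gt_3 by simp
    also have "of_nat (p - 1) * (\<Sum>j<s. of_nat j ^ (p - 2)) = (\<Sum>i\<le>p - 2. of_nat (p - 1 choose i) * bernoulli i * of_nat s ^ (p - 1 - i))"
      using faulhaber[of "p - 2" s] unfolding pm .
    finally show "(\<Sum>j = 1..<s. of_nat j ^ (p - 2) * of_nat s ^ (p - 3)) = of_nat s ^ (p - 3) * (1 / of_nat (p - 1)) *
       (\<Sum>i\<le>p - 2. of_nat (p - 1 choose i) * bernoulli i * of_nat s ^ (p - 1 - i))"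
      by (simp only: sum_distrib_right[symmetric] mult_ac)
  qed
  also have "\<dots> = (\<Sum>i\<le>p - 2. (1 / of_nat (p - 1) * of_nat (p - 1 choose i) * bernoulli i) * (\<Sum>s = 1..<p. of_nat s ^ (p - 3 + (p - 1 - i))))"
    unfolding sum_distrib_left power_add
    by (subst sum.swap) (simp only: mult_ac)
  also have "eqm 1 \<dots> (\<Sum>i\<le>p - 2. (1 / of_nat (p - 1) * of_nat (p - 1 choose i) * bernoulli i) * (if i = p - 3 then - 1 else 0))"
  proof (rule eqm_sum, rule eqm_scale0)
    fix i assume i: "i \<in> {..p - 2}"
    show "pdiv 0 (1 / of_nat (p - 1) * of_nat (p - 1 choose i) * bernoulli i)"
      by (intro pdiv_mult_int inv B i pdiv_of_nat)
    show "eqm 1 (\<Sum>s = 1..<p. of_nat s ^ (p - 3 + (p - 1 - i))) (if i = p - 3 then - 1 else 0)"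
    \<comment> \<open>For i = p - 2 the exponent is p - 2, just below the range of
      \<open>power_sum_eqm\<close>.\<close>
    proof (cases "i = p - 2")
      case True
      have "{..<p} = insert 0 {1..<p}" using p_gt_3 by auto
      then have "(\<Sum>s<p. of_nat s ^ (p - 2) :: rat) = (\<Sum>s = 1..<p. of_nat s ^ (p - 2))"
        using p_gt_3 by (simp add: power_0_left)
      moreover have e: "p - 3 + (p - 1 - i) = p - 2" and "i \<noteq> p - 3" using True p_gt_3 by auto
      ultimately show ?thesis unfolding e using pdiv_power_sum[of "p - 2"] p_gt_3 by (simp add: eqm_0_iff)
    next
      case False
      then have "p - 1 \<le> p - 3 + (p - 1 - i)" "p - 3 + (p - 1 - i) < 2 * (p - 1)"
        "p - 3 + (p - 1 - i) = p - 1 \<longleftrightarrow> i = p - 3" using i p_gt_3 by auto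
      then show ?thesis using power_sum_eqm[of "p - 3 + (p - 1 - i)"] by simp
    qed
  qed
  also have "\<dots> = - (of_nat (p - 1 choose (p - 3)) / of_nat (p - 1) * bernoulli (p - 3))"
    using p_gt_3 by (simp add: if_distrib[of "\<lambda>x. _ * x"] cong: if_cong)
  also have "eqm 1 \<dots> (bernoulli (p - 3))"
  proof -
    \<comment> \<open>The remaining coefficient is -(p-2)/2, which is 1 modulo p.\<close>
    have "p - 1 choose (p - 3) = p - 1 choose 2"
      using binomial_symmetric[of 2 "p - 1"] p_gt_3 by (simp add: numeral_3_eq_3 numeral_2_eq_2)
    moreover have "2 * (p - 1 choose 2) = (p - 1) * (p - 2)"
      using binomial_absorption[of 1 "p - 1"] by (simp add: numeral_2_eq_2)
    ultimately have "2 * of_nat (p - 1 choose (p - 3)) = (of_nat (p - 1) * of_nat (p - 2) :: rat)"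
      by (metis of_nat_mult of_nat_numeral)
    moreover have "of_nat (p - 1) \<noteq> (0::rat)" using p_gt_3 by simp
    ultimately have "of_nat (p - 1 choose (p - 3)) / of_nat (p - 1) = (of_nat (p - 2) / 2 :: rat)"
      by (simp add: field_simps)
    then have *: "of_nat (p - 1 choose (p - 3)) / of_nat (p - 1) = ((of_nat p - 2) / 2 :: rat)"
      using p_gt_3 by (simp add: of_nat_diff)
    have "- (of_nat (p - 1 choose (p - 3)) / of_nat (p - 1) * bernoulli (p - 3)) - bernoulli (p - 3) = - (of_nat p * (1 / 2 * bernoulli (p - 3)))"
      unfolding * by (simp add: field_simps)
    moreover have "pdiv 1 (of_nat p * (1 / 2 * bernoulli (p - 3)))"
      using pdiv_p_power[of 1] p_gt_3 by (intro pdiv_mult_int(2) pdiv_mult_int(1) pdiv_bernoulli) auto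
    ultimately show ?thesis by (simp only: eqm_def pdiv_uminus)
  qed
  finally show ?thesis .
qed

end

section \<open>Harmonic sums\<close>

definition recip :: "nat \<Rightarrow> nat \<Rightarrow> rat" where
  "recip a b = 1 / of_nat a * (1 / of_nat b ^ 2)"

definition double_sum :: "nat \<Rightarrow> (nat \<Rightarrow> nat \<Rightarrow> bool) \<Rightarrow> rat" where
  "double_sum h P = (\<Sum>b = 1..h. \<Sum>a = 1..h. if P a b then recip a b else 0)"

lemma double_sum_trichotomy:
  "double_sum h (\<lambda>a b. True) = double_sum h (\<lambda>a b. a < b) + double_sum h (\<lambda>a b. b < a) + (\<Sum>j = 1..h. 1 / of_nat j ^ 3)"
proof -
  have "double_sum h (\<lambda>a b. True) = double_sum h (\<lambda>a b. a < b) + double_sum h (\<lambda>a b. b < a) + double_sum h (\<lambda>a b. a = b)"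
    unfolding double_sum_def sum.distrib[symmetric] by (intro sum.cong refl) auto
  also have "double_sum h (\<lambda>a b. a = b) = (\<Sum>j = 1..h. 1 / of_nat j ^ 3)"
    unfolding double_sum_def by (simp add: recip_def power2_eq_square power3_eq_cube mult.assoc)
  finally show ?thesis .
qed

text \<open>Put s = a + b and use 1/((s-b) b^2) = 1/(s b^2) + 1/(s^2 b) + 1/(s^2 (s-b)). The
  reflection of b to s - b identifies the sums of the last two terms.\<close>

lemma double_sum_partial_fractions:
  "double_sum h (\<lambda>a b. a + b \<le> h) = double_sum h (\<lambda>a b. b < a) + 2 * double_sum h (\<lambda>a b. a < b)"
proof -
  have D: "double_sum h (\<lambda>a b. a < b) = (\<Sum>s = 1..h. 1 / of_nat s ^ 2 * (\<Sum>b = 1..<s. 1 / of_nat b))"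
    unfolding double_sum_def sum_distrib_left
    by (intro sum.cong refl sum.mono_neutral_cong_right) (auto simp: recip_def)
  have E: "double_sum h (\<lambda>a b. b < a) = (\<Sum>s = 1..h. 1 / of_nat s * (\<Sum>b = 1..<s. 1 / of_nat b ^ 2))"
    unfolding double_sum_def sum_distrib_left
    by (subst sum.swap, intro sum.cong refl sum.mono_neutral_cong_right) (auto simp: recip_def)
  have "double_sum h (\<lambda>a b. a + b \<le> h) = (\<Sum>b = 1..h. \<Sum>s = b + 1..h. recip (s - b) b)"
    unfolding double_sum_def
  proof (rule sum.cong[OF refl])
    fix b assume "b \<in> {1..h}"
    have "(\<Sum>a = 1..h. if a + b \<le> h then recip a b else 0) = (\<Sum>a | a \<in> {1..h} \<and> a + b \<le> h. recip a b)"
      by (simp only: sum.inter_filter finite_atLeastAtMost)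
    also have "\<dots> = (\<Sum>s = b + 1..h. recip (s - b) b)"
      by (rule sum.reindex_bij_witness[of _ "\<lambda>s. s - b" "\<lambda>a. a + b"]) auto
    finally show "(\<Sum>a = 1..h. if a + b \<le> h then recip a b else 0) = (\<Sum>s = b + 1..h. recip (s - b) b)" .
  qed
  also have "\<dots> = (\<Sum>s = 1..h. \<Sum>b = 1..<s. recip (s - b) b)"
    by (simp add: sum.Sigma, intro sum.reindex_bij_witness[of _ prod.swap prod.swap]) auto
  also have "\<dots> = (\<Sum>s = 1..h. 1 / of_nat s * (\<Sum>b = 1..<s. 1 / of_nat b ^ 2) + 2 * (1 / of_nat s ^ 2 * (\<Sum>b = 1..<s. 1 / of_nat b)))"
  proof (rule sum.cong[OF refl])
    fix s assume "s \<in> {1..h}"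
    have "recip (s - b) b = 1 / of_nat s * (1 / of_nat b ^ 2) + (1 / of_nat s ^ 2 * (1 / of_nat b) + 1 / of_nat s ^ 2 * (1 / of_nat (s - b)))"
      if "b \<in> {1..<s}" for b
    proof -
      define a where "a = s - b"
      have a: "s = a + b" "a > 0" "b > 0" using that by (auto simp: a_def)
      then have "(of_nat a :: rat) \<noteq> 0" "(of_nat b :: rat) \<noteq> 0" "(of_nat a + of_nat b :: rat) \<noteq> 0" by simp_all
      then show ?thesis unfolding a(1) recip_def
        by (simp add: divide_simps) (simp add: algebra_simps power2_eq_square)
    qed
    then have "(\<Sum>b = 1..<s. recip (s - b) b) = 1 / of_nat s * (\<Sum>b = 1..<s. 1 / of_nat b ^ 2) +
        (1 / of_nat s ^ 2 * (\<Sum>b = 1..<s. 1 / of_nat b) + 1 / of_nat s ^ 2 * (\<Sum>b = 1..<s. 1 / of_nat (s - b)))"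
      by (simp only: sum.distrib sum_distrib_left cong: sum.cong)
    also have "(\<Sum>b = 1..<s. 1 / of_nat (s - b)) = (\<Sum>b = 1..<s. 1 / of_nat b :: rat)"
      by (rule sum.reindex_bij_witness[of _ "\<lambda>b. s - b" "\<lambda>b. s - b"]) auto
    finally show "(\<Sum>b = 1..<s. recip (s - b) b) = 1 / of_nat s * (\<Sum>b = 1..<s. 1 / of_nat b ^ 2) + 2 * (1 / of_nat s ^ 2 * (\<Sum>b = 1..<s. 1 / of_nat b))"
      by simp
  qed
  finally show ?thesis unfolding D E sum.distrib sum_distrib_left .
qed

lemma sum_split_reflect:
  fixes F :: "nat \<Rightarrow> 'a::comm_monoid_add"
  shows "(\<Sum>x = 1..<2 * h + 1. F x) = (\<Sum>k = 1..h. F k + F (2 * h + 1 - k))"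
proof -
  have "{1..<2 * h + 1} = {1..h} \<union> {h + 1..<2 * h + 1}" by auto
  then have "(\<Sum>x = 1..<2 * h + 1. F x) = (\<Sum>x = 1..h. F x) + (\<Sum>x = h + 1..<2 * h + 1. F x)"
    by (simp only:) (rule sum.union_disjoint, auto)
  also have "(\<Sum>x = h + 1..<2 * h + 1. F x) = (\<Sum>k = 1..h. F (2 * h + 1 - k))"
    by (rule sum.reindex_bij_witness[of _ "\<lambda>k. 2 * h + 1 - k" "\<lambda>k. 2 * h + 1 - k"]) auto
  finally show ?thesis by (simp only: sum.distrib)
qed

text \<open>Because 2h+1 is odd, the odd x in the range are exactly the numbers 2h+1-2k.\<close>

lemma sum_split_parity:
  fixes F :: "nat \<Rightarrow> 'a::comm_monoid_add"
  shows "(\<Sum>x = 1..<2 * h + 1. F x) = (\<Sum>k = 1..h. F (2 * k) + F (2 * h + 1 - 2 * k))"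
proof -
  have "(\<Sum>x = 1..<2 * h + 1. F x) = sum F ({x \<in> {1..<2 * h + 1}. even x} \<union> {x \<in> {1..<2 * h + 1}. odd x})"
    by (rule arg_cong[of _ _ "sum F"]) auto
  also have "\<dots> = (\<Sum>x | x \<in> {1..<2 * h + 1} \<and> even x. F x) + (\<Sum>x | x \<in> {1..<2 * h + 1} \<and> odd x. F x)"
    by (rule sum.union_disjoint) auto
  also have "(\<Sum>x | x \<in> {1..<2 * h + 1} \<and> even x. F x) = (\<Sum>k = 1..h. F (2 * k))"
    by (rule sum.reindex_bij_witness[of _ "\<lambda>k. 2 * k" "\<lambda>x. x div 2"]) auto
  also have "(\<Sum>x | x \<in> {1..<2 * h + 1} \<and> odd x. F x) = (\<Sum>k = 1..h. F (2 * h + 1 - 2 * k))"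
    by (rule sum.reindex_bij_witness[of _ "\<lambda>k. 2 * h + 1 - 2 * k" "\<lambda>x. (2 * h + 1 - x) div 2"])
      (auto elim!: oddE)
  finally show ?thesis by (simp only: sum.distrib)
qed

section \<open>Harmonic sums up to (p-1)/2 modulo powers of p\<close>

locale half_prime = large_prime +
  fixes h :: nat
  assumes p_eq: "p = 2 * h + 1"
begin

definition harm :: "nat \<Rightarrow> rat" where "harm m = (\<Sum>j = 1..h. 1 / of_nat j ^ m)"

lemmas split_reflect = sum_split_reflect[of _ h, folded p_eq]
lemmas split_parity = sum_split_parity[of _ h, folded p_eq]

lemma pdiv_inv: "0 < c \<Longrightarrow> c < p \<Longrightarrow> pdiv 0 (1 / of_nat c ^ m)"
  using pdiv_0_power[OF pdiv_inverse_less] by (simp add: power_one_over)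

lemma pdiv_inv_half: "c \<in> {1..h} \<Longrightarrow> pdiv 0 (1 / of_nat c ^ m)"
  using p_eq by (intro pdiv_inv) auto

lemma pdiv_p: "pdiv 1 (of_nat p)" using pdiv_p_power[of 1] by simp

lemma eqm_inverse_reflect:
  assumes "0 < c" "c < p"
  shows "eqm 1 (1 / of_nat (p - c)) (- (1 / of_nat c))"
    and "eqm 1 (1 / of_nat (p - c) ^ 2) (1 / of_nat c ^ 2)"
    and "eqm 2 (1 / of_nat (p - c) ^ 2) (1 / of_nat c ^ 2 + 2 * of_nat p * (1 / of_nat c ^ 3))"
proof -
  define d :: rat where "d = of_nat (p - c)"
  define e :: rat where "e = of_nat c"
  have d: "d = of_nat p - e" using assms by (simp add: d_def e_def of_nat_diff)
  have nz: "d \<noteq> 0" "e \<noteq> 0" using assms by (simp_all add: d_def e_def)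
  have i: "pdiv 0 (1 / d ^ m)" "pdiv 0 (1 / e ^ m)" for m
    unfolding d_def e_def by (rule pdiv_inv; use assms in simp)+
  have i1: "pdiv 0 (1 / d)" "pdiv 0 (1 / e)" using i(1)[of 1] i(2)[of 1] by simp_all
  have "1 / d - - (1 / e) = of_nat p * (1 / d * (1 / e))"
    using nz unfolding d by (simp add: field_simps)
  then have 1: "eqm 1 (1 / d) (- (1 / e))" unfolding eqm_def
    using i1 pdiv_p by (simp only: pdiv_mult_int)
  then show "eqm 1 (1 / of_nat (p - c)) (- (1 / of_nat c))" by (simp add: d_def e_def)
  have "eqm 1 (1 / d * (1 / d)) (- (1 / e) * - (1 / e))"
    using i1 by (intro eqm_mult 1) simp_all
  then show "eqm 1 (1 / of_nat (p - c) ^ 2) (1 / of_nat c ^ 2)"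
    by (simp add: d_def e_def power2_eq_square)
  \<comment> \<open>An exact formula for the error of the first-order expansion of 1/(p-e)^2 shows
    the factor p^2.\<close>
  have "1 / d ^ 2 - (1 / e ^ 2 + 2 * of_nat p * (1 / e ^ 3)) =
      of_nat p ^ 2 * ((3 * e - 2 * of_nat p) * (1 / d ^ 2 * (1 / e ^ 3)))"
  proof -
    have "e ^ 3 - (e + 2 * of_nat p) * d ^ 2 = of_nat p ^ 2 * (3 * e - 2 * of_nat p)"
      unfolding d by (simp add: algebra_simps power2_eq_square power3_eq_cube)
    moreover have "u - (e * v + 2 * of_nat p * v) = (e ^ 3 - (e + 2 * of_nat p) * d ^ 2) * (u * v)"
      if "d ^ 2 * u = 1" "e ^ 3 * v = 1" for u v
    proof -
      have "(e ^ 3 - (e + 2 * of_nat p) * d ^ 2) * (u * v) = (e ^ 3 * v) * u - (e + 2 * of_nat p) * v * (d ^ 2 * u)"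
        by (simp add: algebra_simps)
      then show ?thesis unfolding that by (simp add: algebra_simps)
    qed
    from this[of "1 / d ^ 2" "1 / e ^ 3"]
    have "1 / d ^ 2 - (1 / e ^ 2 + 2 * of_nat p * (1 / e ^ 3)) = (e ^ 3 - (e + 2 * of_nat p) * d ^ 2) * (1 / d ^ 2 * (1 / e ^ 3))"
      using nz by (simp add: power2_eq_square power3_eq_cube)
    ultimately show ?thesis by (simp only: mult.assoc)
  qed
  moreover have "pdiv 0 (3 * e - 2 * of_nat p)"
    unfolding e_def by (intro pdiv_diff pdiv_mult_int) simp_all
  ultimately have "eqm 2 (1 / d ^ 2) (1 / e ^ 2 + 2 * of_nat p * (1 / e ^ 3))"
    unfolding eqm_def using i pdiv_p_power[of 2] by (simp only: pdiv_mult_int)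
  then show "eqm 2 (1 / of_nat (p - c) ^ 2) (1 / of_nat c ^ 2 + 2 * of_nat p * (1 / of_nat c ^ 3))"
    by (simp add: d_def e_def)
qed

text \<open>The sum of 1/x^2 over 0 < x < p is computed twice: pairing x with p - x gives 2 H_2 + 2p
  H_3, splitting by parity gives H_2/2 + p H_3/4, where H_m is \<open>harm m\<close>. Two thirds of
  the difference yields the constant 7/6.\<close>

lemma harm_2_eqm: "eqm 2 (harm 2) (- (7 / 6) * of_nat p * harm 3)"
proof -
  let ?F = "\<Sum>x = 1..<p. 1 / of_nat x ^ 2 :: rat"
  have 1: "eqm 2 ?F (\<Sum>k = 1..h. 1 / of_nat k ^ 2 + (1 / of_nat k ^ 2 + 2 * of_nat p * (1 / of_nat k ^ 3)))"
    unfolding split_reflect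
    by (intro eqm_sum eqm_add eqm_refl eqm_inverse_reflect) (auto simp: p_eq)
  have 2: "eqm 2 ?F (\<Sum>k = 1..h. 1 / of_nat (2 * k) ^ 2 + (1 / of_nat (2 * k) ^ 2 + 2 * of_nat p * (1 / of_nat (2 * k) ^ 3)))"
    unfolding split_parity
    by (intro eqm_sum eqm_add eqm_refl eqm_inverse_reflect) (auto simp: p_eq)
  have 3: "(\<Sum>k = 1..h. 1 / of_nat k ^ 2 + (1 / of_nat k ^ 2 + 2 * of_nat p * (1 / of_nat k ^ 3))) = 2 * harm 2 + 2 * of_nat p * harm 3"
    unfolding harm_def sum_distrib_left sum.distrib[symmetric] by (intro sum.cong refl) simp
  have 4: "(\<Sum>k = 1..h. 1 / of_nat (2 * k) ^ 2 + (1 / of_nat (2 * k) ^ 2 + 2 * of_nat p * (1 / of_nat (2 * k) ^ 3))) = harm 2 / 2 + of_nat p * harm 3 / 4"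
    unfolding harm_def sum_distrib_left sum_divide_distrib sum.distrib[symmetric]
    by (intro sum.cong refl) (simp add: power_mult_distrib)
  have "eqm 2 (2 * harm 2 + 2 * of_nat p * harm 3) (harm 2 / 2 + of_nat p * harm 3 / 4)"
    using eqm_trans[OF eqm_sym[OF 1] 2] unfolding 3 4 .
  then have "pdiv 2 (2 * (1 / 3) * ((2 * harm 2 + 2 * of_nat p * harm 3) - (harm 2 / 2 + of_nat p * harm 3 / 4)))"
    unfolding eqm_def by (intro pdiv_mult_int(1)) simp_all
  also have "2 * (1 / 3) * ((2 * harm 2 + 2 * of_nat p * harm 3) - (harm 2 / 2 + of_nat p * harm 3 / 4)) =
      harm 2 - - (7 / 6) * of_nat p * harm 3"
    by (simp add: field_simps)
  finally show ?thesis unfolding eqm_def .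
qed

text \<open>An odd a < 2j is p - 2k with k + j > h, and 1/(p-2k) is -1/(2k) modulo p.\<close>

lemma odds_eqm:
  assumes "j \<in> {1..h}"
  shows "eqm 1 (\<Sum>a\<in>odds j. 1 / of_nat a) (\<Sum>k = 1..h. if k + j \<le> h then 0 else - (1 / 2 * (1 / of_nat k)))"
proof -
  have 1: "(\<Sum>a\<in>odds j. 1 / of_nat a) = (\<Sum>k | k \<in> {1..h} \<and> \<not> k + j \<le> h. 1 / of_nat (p - 2 * k) :: rat)"
  proof (rule sum.reindex_bij_witness[of _ "\<lambda>k. p - 2 * k" "\<lambda>a. (p - a) div 2"])
    fix a assume "a \<in> odds j"
    then obtain i where i: "a = 2 * i + 1" "i < j" by (auto simp: odds_def elim!: oddE)
    then have "(p - a) div 2 = h - i" by (simp add: p_eq)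
    then show "p - 2 * ((p - a) div 2) = a" "(p - a) div 2 \<in> {k \<in> {1..h}. \<not> k + j \<le> h}"
      "1 / of_nat (p - 2 * ((p - a) div 2)) = (1 / of_nat a :: rat)"
      using i assms by (simp_all add: p_eq) linarith
  next
    fix k assume k: "k \<in> {k \<in> {1..h}. \<not> k + j \<le> h}"
    then have "p - 2 * k = 2 * (h - k) + 1" by (auto simp: p_eq)
    with k show "(p - (p - 2 * k)) div 2 = k" "p - 2 * k \<in> odds j"
      by (auto simp: odds_def p_eq)
  qed
  have 2: "(\<Sum>k | k \<in> {1..h} \<and> \<not> k + j \<le> h. - (1 / of_nat (2 * k))) =
      (\<Sum>k = 1..h. if k + j \<le> h then 0 else - (1 / 2 * (1 / of_nat k)) :: rat)"
    unfolding sum.inter_filter[OF finite_atLeastAtMost] by (intro sum.cong refl) simp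
  show ?thesis unfolding 1 2[symmetric]
  proof (rule eqm_sum, rule eqm_inverse_reflect(1))
    fix k assume "k \<in> {k \<in> {1..h}. \<not> k + j \<le> h}"
    then show "0 < 2 * k" "2 * k < p" by (auto simp: p_eq)
  qed
qed

lemma odds_sum_eqm:
  "eqm 1 (\<Sum>j = 1..h. 1 / of_nat j ^ 2 * (\<Sum>a\<in>odds j. 1 / of_nat a))
     (- (1 / 2) * (double_sum h (\<lambda>a b. True) - double_sum h (\<lambda>a b. a + b \<le> h)))"
proof -
  have "eqm 1 (\<Sum>j = 1..h. 1 / of_nat j ^ 2 * (\<Sum>a\<in>odds j. 1 / of_nat a))
     (\<Sum>j = 1..h. 1 / of_nat j ^ 2 * (\<Sum>k = 1..h. if k + j \<le> h then 0 else - (1 / 2 * (1 / of_nat k))))"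
    by (intro eqm_sum eqm_scale0 odds_eqm pdiv_inv_half)
  also have "\<dots> = - (1 / 2) * (double_sum h (\<lambda>a b. True) - double_sum h (\<lambda>a b. a + b \<le> h))"
    unfolding double_sum_def sum_subtractf[symmetric] sum_distrib_left
    by (intro sum.cong refl) (simp add: recip_def)
  finally show ?thesis .
qed

lemma recip_eqm:
  assumes "0 < a" "a < p" "0 < b" "b < p"
  shows "eqm 1 (recip (p - a) b) (- recip a b)" "eqm 1 (recip a (p - b)) (recip a b)"
    "eqm 1 (recip (p - a) (p - b)) (- recip a b)"
proof -
  have i: "pdiv 0 (1 / of_nat c)" "pdiv 0 (1 / of_nat c ^ 2)" if "0 < c" "c < p" for c
    using that pdiv_inv[of c 1] pdiv_inv[of c 2] by simp_all
  have m: "eqm 1 (recip x y) (u * v)" if "eqm 1 (1 / of_nat x) u" "eqm 1 (1 / of_nat y ^ 2) v" "0 < x" "x < p" "pdiv 0 v" for x y u v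
    unfolding recip_def using that i by (intro eqm_mult) auto
  note r = eqm_inverse_reflect
  show "eqm 1 (recip (p - a) b) (- recip a b)"
    using m[OF r(1)[of a] eqm_refl, of b] i assms by (simp add: recip_def)
  show "eqm 1 (recip a (p - b)) (recip a b)"
    using m[OF eqm_refl[of 1 "1 / of_nat a"] r(2)[of b]] i assms by (simp add: recip_def)
  show "eqm 1 (recip (p - a) (p - b)) (- recip a b)"
    using m[OF r(1)[of a] r(2)[of b]] i assms by (simp add: recip_def)
qed

section \<open>Two evaluations of the double sum that represents the Bernoulli number\<close>

definition full_sum :: rat where
  "full_sum = (\<Sum>s = 1..<p. \<Sum>j = 1..<s. recip j s)"

lemma full_sum_eq: "full_sum = (\<Sum>s = 1..<p. \<Sum>j = 1..<p. if j < s then recip j s else 0)"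
  unfolding full_sum_def
  by (intro sum.cong refl sum.mono_neutral_cong_left) auto

text \<open>Each index is x or p - x with x <= h. Of the four blocks, j large with s small is empty,
  j small with s large is the full square, and two large indices reverse the order and the
  sign.\<close>

lemma full_sum_reflect:
  "eqm 1 full_sum (double_sum h (\<lambda>a b. a < b) + double_sum h (\<lambda>a b. True) - double_sum h (\<lambda>a b. b < a))"
proof -
  let ?X = "\<lambda>j s. if j < s then recip j s else 0"
  have expand: "full_sum = (\<Sum>b = 1..h. \<Sum>a = 1..h. ?X a b + ?X (p - a) b + (?X a (p - b) + ?X (p - a) (p - b)))"
    unfolding full_sum_eq split_reflect sum.distrib by (simp only: ac_simps)
  have "eqm 1 full_sum (\<Sum>b = 1..h. \<Sum>a = 1..h. (if a < b then recip a b else 0) + recip a b - (if b < a then recip a b else 0))"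
    unfolding expand
  proof (intro eqm_sum)
    fix a b assume ab: "a \<in> {1..h}" "b \<in> {1..h}"
    then have lt: "0 < a" "a < p" "0 < b" "b < p" by (auto simp: p_eq)
    from ab have "?X (p - a) b = 0" "?X a (p - b) = recip a (p - b)"
      "?X (p - a) (p - b) = (if b < a then recip (p - a) (p - b) else 0)" by (auto simp: p_eq)
    moreover have "eqm 1 (if b < a then recip (p - a) (p - b) else 0) (- (if b < a then recip a b else 0))"
      using recip_eqm(3)[OF lt] by simp
    moreover have "eqm 1 (recip a (p - b)) (recip a b)"
      using recip_eqm(2)[OF lt] by simp
    ultimately have "eqm 1 (?X a b + ?X (p - a) b + (?X a (p - b) + ?X (p - a) (p - b)))
      (?X a b + 0 + (recip a b + - (if b < a then recip a b else 0)))"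
      by (simp only:) (intro eqm_add eqm_refl)
    then show "eqm 1 (?X a b + ?X (p - a) b + (?X a (p - b) + ?X (p - a) (p - b)))
      (?X a b + recip a b - (if b < a then recip a b else 0))"
      by (simp only: add_0_right add_uminus_conv_diff add_diff_eq)
  qed
  then show ?thesis by (simp only: double_sum_def sum.distrib sum_subtractf if_True)
qed

text \<open>Now each index is 2x or p - 2x. The mixed blocks carry the conditions a + b > h (with a
  minus sign) and a + b <= h; the factor 8 clears the doubling in \<open>recip\<close>.\<close>

lemma full_sum_parity:
  "eqm 1 (8 * full_sum) (double_sum h (\<lambda>a b. a < b) - double_sum h (\<lambda>a b. True)
     + 2 * double_sum h (\<lambda>a b. a + b \<le> h) - double_sum h (\<lambda>a b. b < a))"
proof -
  let ?X = "\<lambda>j s. if j < s then recip j s else 0"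
  let ?R = "\<lambda>a b. (if a < b then recip a b else 0) - recip a b + 2 * (if a + b \<le> h then recip a b else 0) - (if b < a then recip a b else 0)"
  have expand: "full_sum = (\<Sum>b = 1..h. \<Sum>a = 1..h. ?X (2 * a) (2 * b) + ?X (p - 2 * a) (2 * b) + (?X (2 * a) (p - 2 * b) + ?X (p - 2 * a) (p - 2 * b)))"
    unfolding full_sum_eq split_parity sum.distrib by (simp only: ac_simps)
  have "eqm 1 full_sum (\<Sum>b = 1..h. \<Sum>a = 1..h. 1 / 8 * ?R a b)"
    unfolding expand
  proof (intro eqm_sum)
    fix a b assume ab: "a \<in> {1..h}" "b \<in> {1..h}"
    then have lt: "0 < 2 * a" "2 * a < p" "0 < 2 * b" "2 * b < p" by (auto simp: p_eq)
    let ?t = "recip (2 * a) (2 * b)"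
    have t: "?t = 1 / 8 * recip a b" by (simp add: recip_def power_mult_distrib)
    have "2 * a < 2 * b \<longleftrightarrow> a < b" "p - 2 * a < 2 * b \<longleftrightarrow> \<not> a + b \<le> h"
      "2 * a < p - 2 * b \<longleftrightarrow> a + b \<le> h" "p - 2 * a < p - 2 * b \<longleftrightarrow> b < a"
      using ab unfolding p_eq atLeastAtMost_iff by linarith+
    moreover have "eqm 1 (if \<not> a + b \<le> h then recip (p - 2 * a) (2 * b) else 0) (if \<not> a + b \<le> h then - ?t else 0)"
      using recip_eqm(1)[OF lt] by simp
    moreover have "eqm 1 (if a + b \<le> h then recip (2 * a) (p - 2 * b) else 0) (if a + b \<le> h then ?t else 0)"
      using recip_eqm(2)[OF lt] by simp
    moreover have "eqm 1 (if b < a then recip (p - 2 * a) (p - 2 * b) else 0) (if b < a then - ?t else 0)"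
      using recip_eqm(3)[OF lt] by simp
    ultimately have "eqm 1 (?X (2 * a) (2 * b) + ?X (p - 2 * a) (2 * b) + (?X (2 * a) (p - 2 * b) + ?X (p - 2 * a) (p - 2 * b)))
      ((if a < b then ?t else 0) + (if \<not> a + b \<le> h then - ?t else 0) + ((if a + b \<le> h then ?t else 0) + (if b < a then - ?t else 0)))"
      by (simp only:) (intro eqm_add eqm_refl)
    also have "\<dots> = 1 / 8 * ?R a b" unfolding t
      by (cases "a < b"; cases "b < a"; cases "a + b \<le> h") simp_all
    finally show "eqm 1 (?X (2 * a) (2 * b) + ?X (p - 2 * a) (2 * b) + (?X (2 * a) (p - 2 * b) + ?X (p - 2 * a) (p - 2 * b)))
      (1 / 8 * ?R a b)" .
  qed
  then have "eqm 1 (8 * full_sum) (8 * (\<Sum>b = 1..h. \<Sum>a = 1..h. 1 / 8 * ?R a b))"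
    by (rule eqm_scale0) simp
  moreover have "8 * (\<Sum>b = 1..h. \<Sum>a = 1..h. 1 / 8 * ?R a b) = (\<Sum>b = 1..h. \<Sum>a = 1..h. ?R a b)"
  proof -
    have "8 * (1 / 8 * x) = x" for x :: rat by simp
    then show ?thesis unfolding sum_distrib_left by (simp only:)
  qed
  moreover have "(\<Sum>b = 1..h. \<Sum>a = 1..h. ?R a b) = double_sum h (\<lambda>a b. a < b) - double_sum h (\<lambda>a b. True)
     + 2 * double_sum h (\<lambda>a b. a + b \<le> h) - double_sum h (\<lambda>a b. b < a)"
    unfolding double_sum_def sum.distrib sum_subtractf sum_distrib_left if_True ..
  ultimately show ?thesis by (simp only:)
qed

lemma prime_case:
  "eqm 4 (\<Sum>j = 1..h. (of_nat p / of_nat j) ^ 2 * (2 * (\<Sum>a\<in>odds j. of_nat p / of_nat a) - 1))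
     (7 / 6 * of_nat p ^ 3 * bernoulli (p - 3))"
proof -
  define D where "D = double_sum h (\<lambda>a b. a < b)"
  define E where "E = double_sum h (\<lambda>a b. b < a)"
  define C where "C = double_sum h (\<lambda>a b. a + b \<le> h)"
  define T where "T = double_sum h (\<lambda>a b. True)"
  define G where "G = (\<Sum>j = 1..h. 1 / of_nat j ^ 2 * (\<Sum>a\<in>odds j. 1 / of_nat a) :: rat)"
  define W where "W = full_sum"
  have eqs: "T = D + E + harm 3" "C = E + 2 * D"
    unfolding T_def C_def D_def E_def harm_def
    by (rule double_sum_trichotomy) (rule double_sum_partial_fractions)
  have W: "pdiv 1 (W - (D + T - E))" "pdiv 1 (8 * W - (D - T + 2 * C - E))"
    using full_sum_reflect full_sum_parity unfolding eqm_def D_def E_def C_def T_def W_def by simp_all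
  have G: "eqm 1 G (- (1 / 2) * (T - C))"
    using odds_sum_eqm unfolding G_def T_def C_def .
  have "eqm 1 (2 * G + 7 / 6 * harm 3) (7 / 6 * W)"
  proof -
    \<comment> \<open>After elimination of T and C three congruences remain, G = (D - H)/2, W = 2D +
      H and 8W = 4D - H with H = \<open>harm 3\<close>. They combine with weights 2, -5/18 and -1/9;
      the weights are written as products of factors known to be p-integral.\<close>
    have "2 * G + 7 / 6 * harm 3 - 7 / 6 * W = 2 * (G - (- (1 / 2) * (T - C)))
        - 5 * (1 / 2) * (1 / 3) * (1 / 3) * (W - (D + T - E)) - 1 / 3 * (1 / 3) * (8 * W - (D - T + 2 * C - E))"
      unfolding eqs by (simp add: field_simps)
    moreover have "pdiv 1 \<dots>"
      using W G[unfolded eqm_def] by (intro pdiv_diff[OF pdiv_diff] pdiv_mult_int(1)) (simp_all only: pdiv_numeral pdiv_inverse_numeral)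
    ultimately show ?thesis unfolding eqm_def by (simp only:)
  qed
  also have "eqm 1 \<dots> (7 / 6 * bernoulli (p - 3))"
  proof -
    have "pdiv 0 (7 / 6)" using pdiv_mult_int(1)[of 7 0 "1 / 6"] by simp
    then show ?thesis unfolding W_def full_sum_def recip_def
      by (rule eqm_scale0[OF double_harmonic_bernoulli])
  qed
  finally have "eqm 1 (2 * G + 7 / 6 * harm 3) (7 / 6 * bernoulli (p - 3))" .
  from eqm_scale[OF this pdiv_p]
  have "eqm 2 (of_nat p * (2 * G + 7 / 6 * harm 3)) (of_nat p * (7 / 6 * bernoulli (p - 3)))"
    by (simp only: one_add_one)
  \<comment> \<open>Replacing \<open>harm 2\<close> by its value modulo p^2 exposes a factor p, so
    the bracket was needed only modulo p.\<close>
  moreover have "eqm 2 (2 * of_nat p * G - harm 2) (of_nat p * (2 * G + 7 / 6 * harm 3))"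
    using eqm_diff[OF eqm_refl harm_2_eqm, of "2 * of_nat p * G"] by (simp add: algebra_simps)
  ultimately have "eqm 2 (2 * of_nat p * G - harm 2) (of_nat p * (7 / 6 * bernoulli (p - 3)))"
    by (rule eqm_trans[rotated])
  from eqm_scale[OF this pdiv_p_power[of 2]]
  have "eqm 4 (of_nat p ^ 2 * (2 * of_nat p * G - harm 2)) (7 / 6 * of_nat p ^ 3 * bernoulli (p - 3))"
    by (simp add: power2_eq_square power3_eq_cube mult_ac)
  moreover have "of_nat p ^ 2 * (2 * of_nat p * G - harm 2) =
      (\<Sum>j = 1..h. (of_nat p / of_nat j) ^ 2 * (2 * (\<Sum>a\<in>odds j. of_nat p / of_nat a) - 1))"
  proof -
    define Y where "Y j = (\<Sum>a\<in>odds j. 1 / of_nat a :: rat)" for j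
    have Y: "(\<Sum>a\<in>odds j. of_nat p / of_nat a) = of_nat p * Y j" for j
      unfolding Y_def sum_distrib_left by simp
    show ?thesis
      unfolding G_def harm_def Y Y_def[symmetric] right_diff_distrib sum_distrib_left sum_subtractf[symmetric]
      by (intro sum.cong refl) (simp add: power_divide)
  qed
  ultimately show ?thesis by simp
qed

end

section \<open>From the factorised sum to the congruence modulo p^(r+4)\<close>

theorem theorem1p1:
  fixes p r :: nat
  assumes "prime p" and "p > 3" and "r \<ge> 1"
  shows "rat_cong
    (\<Sum>k<p ^ r. of_nat (3 * k + 1) * (pochhammer (1/2 :: rat) k) ^ 3
                 / (pochhammer (1 :: rat) k) ^ 3 * 4 ^ k)
    (of_nat (p ^ r) + 7 / 6 * of_nat (p ^ (r + 3)) * bernoulli (p - 3))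
    p (r + 4)"
proof -
  interpret large_prime p using assms by unfold_locales
  obtain k where k: "p = 2 * k + 1" using p_odd by (elim oddE)
  interpret half_prime p k using k by unfold_locales
  have "odd (p ^ r)" using p_odd by simp
  then obtain h where h: "p ^ r = 2 * h + 1" by (elim oddE)
  define n :: rat where "n = of_nat (p ^ r)"
  define X where "X = (\<Prod>i = 1..h. 1 - (n / of_nat i) ^ 2 / 4) ^ 2 *
      (1 - (\<Sum>j = 1..h. 2 * n ^ 2 / (4 * of_nat j ^ 2 - n ^ 2) * (\<Prod>a\<in>odds j. (n - of_nat a) / (n + of_nat a)) ^ 2))"
  have "eqm 4 X (1 + (\<Sum>j = 1..h. (n / of_nat j) ^ 2 * (2 * (\<Sum>a\<in>odds j. n / of_nat a) - 1)))"
    unfolding X_def n_def by (rule hyp_sum_quotient_eqm[OF h])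
  also have "eqm 4 \<dots> (1 + (\<Sum>j = 1..k. (of_nat p / of_nat j) ^ 2 * (2 * (\<Sum>a\<in>odds j. of_nat p / of_nat a) - 1)))"
    unfolding n_def using assms(3) by (intro eqm_add eqm_refl reduce_to_prime[OF h k]) simp
  also have "eqm 4 \<dots> (1 + 7 / 6 * of_nat p ^ 3 * bernoulli (p - 3))"
    by (intro eqm_add eqm_refl prime_case)
  finally have "eqm 4 X (1 + 7 / 6 * of_nat p ^ 3 * bernoulli (p - 3))" .
  \<comment> \<open>The factor n = p^r of the sum lifts the modulus from p^4 to p^(r+4).\<close>
  from eqm_scale[OF this pdiv_p_power[of r]]
  have "eqm (r + 4) (of_nat p ^ r * X) (of_nat p ^ r * (1 + 7 / 6 * of_nat p ^ 3 * bernoulli (p - 3)))" .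
  moreover have "of_nat p ^ r * X = (\<Sum>k<p ^ r. of_nat (3 * k + 1) * (pochhammer (1/2 :: rat) k) ^ 3
                 / (pochhammer (1 :: rat) k) ^ 3 * 4 ^ k)"
    \<comment> \<open>The range p^r is put into the form 2h + 1 for the closed formula and then
      turned back.\<close>
    unfolding h hyp_sum_odd unfolding h[symmetric] X_def n_def by (simp only: of_nat_power mult.assoc)
  moreover have "of_nat p ^ r * (1 + 7 / 6 * of_nat p ^ 3 * bernoulli (p - 3)) =
      of_nat (p ^ r) + 7 / 6 * of_nat (p ^ (r + 3)) * bernoulli (p - 3)"
    by (simp add: algebra_simps power_add)
  ultimately show ?thesis by (intro pdiv_imp_rat_cong) (simp only: eqm_def)
qed

end
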